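(* Let $N$ be a positive odd integer, let $\xi, \zeta \in \mathbb{C}$ satisfy $\xi^N = \zeta^N = 1$, and let $n \ge 1$ be an integer. Let $\alpha = \xi^{E_1(n)}$ and $\beta = \zeta^{E_2(n)}$ where \[ E_1(n) = \frac{N n}{\gcd(N,n)^2} \quad\text{and}\quad E_2(n) = \binom{n}{3} \frac{N^4}{\gcd(N,n)^4}. \] The $n$-th Frobenius-Schur indicator of the regular representation of $H = H_{N^3}(\xi,\zeta)$ is given as follows. If both the condition \[ b_3(n) = b_3(N) = b_3(\mathrm{ord}(\zeta)) \ge 1 \] and the inequality $b_3(\mathrm{ord}(\xi)) \le 1$ hold, then \[ \nu_n(H) = \frac{\gcd(N,n)^3}{9\, \mathrm{ord}(\alpha)} \times \begin{cases} 5 + 4\beta & \text{if } b_3(\mathrm{ord}(\xi)) = 0, \\ 3(5 - 2\beta) & \text{if } b_3(\mathrm{ord}(\xi)) = 1. \end{cases} \] Otherwise, $\nu_n(H) = \gcd(N,n)^3/\mathrm{ord}(\alpha)$.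
   Context: For a prime $p$ and a positive integer $m$, $b_p(m)$ is the largest integer $i \ge 0$ such that $p^i$ divides $m$. $\mathrm{ord}(z)$ is the multiplicative order of a root of unity $z$. The Hopf algebra $H_{N^3}(\xi,\zeta)$ (Masuoka), of dimension $N^3$ over $\mathbb{C}$: let $G = \mathbb{Z}_N \times \mathbb{Z}_N$ and let $e_{ij}$ ($i,j\in\mathbb{Z}_N$) be the basis of $\mathbb{C}^G$ dual to the elements $(i,j) \in G$. $H_{N^3}(\xi,\zeta)$ is the algebra generated by $\mathbb{C}^G$ and an element $x$ with relations $x^N = \sum_{i,j \in \mathbb{Z}_N} \xi^j e_{ij}$ and $x e_{ij} = e_{i-j,j} x$ (basis $e_{ij} x^k$, $0 \le k < N$). The comultiplication is the algebra map with $\Delta(x) = \sum_{p,q,r,s \in \mathbb{Z}_N} \zeta^{qr} e_{pq} x \otimes e_{rs} x$ and $\Delta(e_{ij}) = \sum_{p,q \in \mathbb{Z}_N} e_{i-p,j-q} \otimes e_{pq}$; the counit is the algebra map with $\varepsilon(x)=1$, $\varepsilon(e_{ij}) = \delta_{i0}\delta_{j0}$. It is semisimple. For a finite-dimensional semisimple Hopf algebra $H$ over $\mathbb{C}$, $\nu_n(H) = \chi_H(\Lambda_{(1)} \Lambda_{(2)} \cdots \Lambda_{(n)})$, where $\Lambda \in H$ is the integral with $\varepsilon(\Lambda) = 1$, Sweedler notation is used for the iterated comultiplication, and $\chi_H$ is the character of the (left) regular representation.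
   Formalization: The formal theorem takes β = ζ^{-E_2(n)} instead of ζ^{E_2(n)}: with the stated relations and comultiplication the printed sign fails, e.g. N = n = 3, ξ = 1, ζ a primitive cube root of unity gives ν_3 = 15 + 12ζ^{-1}, not 15 + 12ζ. *)

theory Defs
  imports Complex_Main "HOL-Computational_Algebra.Primes" "HOL-Number_Theory.Cong"
begin

text \<open>
  A finite-dimensional complex algebra is given by a finite basis and structure constants; its
  elements are the complex-valued functions that vanish off the basis, and elements of tensor
  products are functions on pairs (or lists) of basis indices.
\<close>

record 'b alg =
  basis :: "'b set"
  sconst :: "'b \<Rightarrow> 'b \<Rightarrow> 'b \<Rightarrow> complex"
  unity :: "'b \<Rightarrow> complex"

definition elts :: "('b, 'm) alg_scheme \<Rightarrow> ('b \<Rightarrow> complex) set" where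
  "elts A = {u. \<forall>b. b \<notin> basis A \<longrightarrow> u b = 0}"

definition bvec :: "'b \<Rightarrow> 'b \<Rightarrow> complex" where
  "bvec b = (\<lambda>c. if c = b then 1 else 0)"

definition amul :: "('b, 'm) alg_scheme \<Rightarrow> ('b \<Rightarrow> complex) \<Rightarrow> ('b \<Rightarrow> complex) \<Rightarrow> 'b \<Rightarrow> complex" where
  "amul A u v = (\<lambda>c. \<Sum>a\<in>basis A. \<Sum>b\<in>basis A. u a * v b * sconst A a b c)"

primrec apow :: "('b, 'm) alg_scheme \<Rightarrow> ('b \<Rightarrow> complex) \<Rightarrow> nat \<Rightarrow> 'b \<Rightarrow> complex" where
  "apow A u 0 = unity A"
| "apow A u (Suc k) = amul A (apow A u k) u"

definition assoc_unital :: "('b, 'm) alg_scheme \<Rightarrow> bool" where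
  "assoc_unital A \<longleftrightarrow> finite (basis A) \<and> unity A \<in> elts A \<and>
     (\<forall>a\<in>basis A. \<forall>b\<in>basis A. sconst A a b \<in> elts A) \<and>
     (\<forall>u\<in>elts A. \<forall>v\<in>elts A. \<forall>w\<in>elts A. amul A (amul A u v) w = amul A u (amul A v w)) \<and>
     (\<forall>u\<in>elts A. amul A (unity A) u = u \<and> amul A u (unity A) = u)"

definition tens :: "('a \<Rightarrow> complex) \<Rightarrow> ('b \<Rightarrow> complex) \<Rightarrow> 'a \<times> 'b \<Rightarrow> complex" where
  "tens u v = (\<lambda>(a, b). u a * v b)"

definition tensor_alg :: "('a, 'm) alg_scheme \<Rightarrow> ('b, 'n) alg_scheme \<Rightarrow> ('a \<times> 'b) alg" where
  "tensor_alg A B =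
     \<lparr> basis = basis A \<times> basis B,
       sconst = (\<lambda>(a, b) (a', b'). tens (sconst A a a') (sconst B b b')),
       unity = tens (unity A) (unity B) \<rparr>"

text \<open>The comultiplication and counit are recorded by their values on the basis.\<close>

record 'b hopf = "'b alg" +
  comul :: "'b \<Rightarrow> 'b \<times> 'b \<Rightarrow> complex"
  coun :: "'b \<Rightarrow> complex"

definition Delta :: "('b, 'm) hopf_scheme \<Rightarrow> ('b \<Rightarrow> complex) \<Rightarrow> 'b \<times> 'b \<Rightarrow> complex" where
  "Delta H h = (\<lambda>p. \<Sum>b\<in>basis H. h b * comul H b p)"

definition eps :: "('b, 'm) hopf_scheme \<Rightarrow> ('b \<Rightarrow> complex) \<Rightarrow> complex" where
  "eps H h = (\<Sum>b\<in>basis H. h b * coun H b)"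

definition hopf_algebra :: "('b, 'm) hopf_scheme \<Rightarrow> bool" where
  "hopf_algebra H \<longleftrightarrow> assoc_unital H \<and>
     (\<forall>b\<in>basis H. comul H b \<in> elts (tensor_alg H H)) \<and>
     (\<forall>b\<in>basis H. \<forall>c d e.
        (\<Sum>a\<in>basis H. comul H b (a, e) * comul H a (c, d)) =
        (\<Sum>a\<in>basis H. comul H b (c, a) * comul H a (d, e))) \<and>
     (\<forall>b\<in>basis H. \<forall>c.
        (\<Sum>a\<in>basis H. coun H a * comul H b (a, c)) = bvec b c \<and>
        (\<Sum>a\<in>basis H. comul H b (c, a) * coun H a) = bvec b c) \<and>
     Delta H (unity H) = unity (tensor_alg H H) \<and> eps H (unity H) = 1 \<and>
     (\<forall>u\<in>elts H. \<forall>v\<in>elts H.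
        Delta H (amul H u v) = amul (tensor_alg H H) (Delta H u) (Delta H v) \<and>
        eps H (amul H u v) = eps H u * eps H v) \<and>
     (\<exists>S. (\<forall>b\<in>basis H. S b \<in> elts H) \<and>
        (\<forall>b\<in>basis H. \<forall>c.
          (\<Sum>(a, a')\<in>basis H \<times> basis H. comul H b (a, a') * amul H (S a) (bvec a') c)
             = coun H b * unity H c \<and>
          (\<Sum>(a, a')\<in>basis H \<times> basis H. comul H b (a, a') * amul H (bvec a) (S a') c)
             = coun H b * unity H c))"

text \<open>The iterated comultiplication into the tensor power of order \<open>k + 1\<close>; the value at a list of
  \<open>k + 1\<close> basis indices is the coefficient of the corresponding elementary tensor.\<close>

primrec iter_Delta :: "('b, 'm) hopf_scheme \<Rightarrow> nat \<Rightarrow> ('b \<Rightarrow> complex) \<Rightarrow> 'b list \<Rightarrow> complex" where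
  "iter_Delta H 0 h = (\<lambda>bs. case bs of [b] \<Rightarrow> h b | _ \<Rightarrow> 0)"
| "iter_Delta H (Suc k) h = (\<lambda>bs. case bs of [] \<Rightarrow> 0
     | b # bs' \<Rightarrow> (\<Sum>c\<in>basis H. Delta H h (b, c) * iter_Delta H k (bvec c) bs'))"

definition sweedler_power :: "('b, 'm) hopf_scheme \<Rightarrow> nat \<Rightarrow> ('b \<Rightarrow> complex) \<Rightarrow> 'b \<Rightarrow> complex" where
  "sweedler_power H n h = (\<lambda>c. \<Sum>bs | set bs \<subseteq> basis H \<and> length bs = n.
     iter_Delta H (n - 1) h bs * foldr (\<lambda>b v. amul H (bvec b) v) bs (unity H) c)"

definition reg_char :: "('b, 'm) alg_scheme \<Rightarrow> ('b \<Rightarrow> complex) \<Rightarrow> complex" where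
  "reg_char A h = (\<Sum>b\<in>basis A. amul A h (bvec b) b)"

definition normalized_integral :: "('b, 'm) hopf_scheme \<Rightarrow> ('b \<Rightarrow> complex) \<Rightarrow> bool" where
  "normalized_integral H \<Lambda> \<longleftrightarrow> \<Lambda> \<in> elts H \<and> eps H \<Lambda> = 1 \<and>
     (\<forall>h\<in>elts H. amul H h \<Lambda> = (\<lambda>c. eps H h * \<Lambda> c) \<and> amul H \<Lambda> h = (\<lambda>c. eps H h * \<Lambda> c))"

definition FS_indicator :: "nat \<Rightarrow> ('b, 'm) hopf_scheme \<Rightarrow> complex" where
  "FS_indicator n H = reg_char H (sweedler_power H n (THE \<Lambda>. normalized_integral H \<Lambda>))"


text \<open>
  The basis vector indexed by \<open>(i, j, k)\<close> with \<open>0 \<le> i, j < N\<close> and \<open>k < N\<close> is \<open>e\<^sub>i\<^sub>j x\<^sup>k\<close>. For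
  arbitrary \<open>i, j, k\<close>, \<open>monom N \<xi> i j k\<close> is the normal form of \<open>e\<^sub>i\<^sub>j x\<^sup>k\<close>, obtained from
  \<open>e\<^sub>i\<^sub>j x\<^sup>N = \<xi>\<^sup>j e\<^sub>i\<^sub>j\<close>. In particular this is right for \<open>k = 1\<close>, \<open>N = 1\<close>, where \<open>x\<close> is not a
  basis vector of its own.
\<close>

type_synonym midx = "int \<times> int \<times> nat"

definition monom :: "nat \<Rightarrow> complex \<Rightarrow> int \<Rightarrow> int \<Rightarrow> nat \<Rightarrow> midx \<Rightarrow> complex" where
  "monom N \<xi> i j k = (\<lambda>b. if b = (i mod int N, j mod int N, k mod N)
     then \<xi> powi (j mod int N * int (k div N)) else 0)"

text \<open>The product of basis vectors comes from \<open>x\<^sup>k e\<^sub>p\<^sub>q = e\<^sub>r\<^sub>q x\<^sup>k\<close> with \<open>r = p - k q\<close>.\<close>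

definition masuoka_alg :: "nat \<Rightarrow> complex \<Rightarrow> midx alg" where
  "masuoka_alg N \<xi> =
     \<lparr> basis = {0..<int N} \<times> {0..<int N} \<times> {..<N},
       sconst = (\<lambda>(i, j, k) (p, q, l).
         if i = (p - int k * q) mod int N \<and> j = q then monom N \<xi> i j (k + l) else (\<lambda>_. 0)),
       unity = (\<lambda>b. \<Sum>i\<in>{0..<int N}. \<Sum>j\<in>{0..<int N}. monom N \<xi> i j 0 b) \<rparr>"

definition gen_e :: "nat \<Rightarrow> complex \<Rightarrow> int \<Rightarrow> int \<Rightarrow> midx \<Rightarrow> complex" where
  "gen_e N \<xi> i j = monom N \<xi> i j 0"

definition gen_x :: "nat \<Rightarrow> complex \<Rightarrow> midx \<Rightarrow> complex" where
  "gen_x N \<xi> = (\<lambda>b. \<Sum>i\<in>{0..<int N}. \<Sum>j\<in>{0..<int N}. monom N \<xi> i j 1 b)"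

definition Delta_e :: "nat \<Rightarrow> complex \<Rightarrow> int \<Rightarrow> int \<Rightarrow> midx \<times> midx \<Rightarrow> complex" where
  "Delta_e N \<xi> i j = (\<lambda>c. \<Sum>p\<in>{0..<int N}. \<Sum>q\<in>{0..<int N}.
     tens (gen_e N \<xi> (i - p) (j - q)) (gen_e N \<xi> p q) c)"

definition Delta_x :: "nat \<Rightarrow> complex \<Rightarrow> complex \<Rightarrow> midx \<times> midx \<Rightarrow> complex" where
  "Delta_x N \<xi> \<zeta> = (\<lambda>c. \<Sum>p\<in>{0..<int N}. \<Sum>q\<in>{0..<int N}. \<Sum>r\<in>{0..<int N}. \<Sum>s\<in>{0..<int N}.
     \<zeta> powi (q * r) * tens (amul (masuoka_alg N \<xi>) (gen_e N \<xi> p q) (gen_x N \<xi>))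
                          (amul (masuoka_alg N \<xi>) (gen_e N \<xi> r s) (gen_x N \<xi>)) c)"

text \<open>\<open>\<Delta>\<close> and \<open>\<epsilon>\<close> are the multiplicative extensions of their values on the generators.\<close>

definition masuoka :: "nat \<Rightarrow> complex \<Rightarrow> complex \<Rightarrow> midx hopf" where
  "masuoka N \<xi> \<zeta> = alg.extend (masuoka_alg N \<xi>)
     \<lparr> comul = (\<lambda>(i, j, k).
         let T = tensor_alg (masuoka_alg N \<xi>) (masuoka_alg N \<xi>)
         in amul T (Delta_e N \<xi> i j) (apow T (Delta_x N \<xi> \<zeta>) k)),
       coun = (\<lambda>(i, j, k). (if i = 0 \<and> j = 0 then 1 else 0) * 1 ^ k) \<rparr>"

text \<open>
  A sign to be aware of: with the relation \<open>x e\<^sub>i\<^sub>j = e\<^sub>i\<^sub>-\<^sub>j\<^sub>,\<^sub>j x\<close> and this \<open>\<Delta>(x)\<close>, indicators involve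
  negative powers of \<open>\<zeta>\<close>. For \<open>N = n = 3\<close>, \<open>\<xi> = 1\<close> the \<open>n\<close>-th indicator of the regular
  representation is the sum of \<open>\<zeta>\<close> to the power \<open>5 j\<^sup>2 k\<^sup>2\<close> over \<open>0 \<le> i, j, k < 3\<close>, that is
  \<open>15 + 12 \<zeta>\<^sup>2 = 15 + 12 / \<zeta>\<close> for a primitive cube root of unity \<open>\<zeta>\<close>.
\<close>

text \<open>The value is meaningful only for roots of unity.\<close>

definition root_ord :: "complex \<Rightarrow> nat" where
  "root_ord z = (LEAST d. 0 < d \<and> z ^ d = 1)"

text \<open>
  The remainder of this theory confirms that \<open>masuoka N \<xi> \<zeta>\<close> is the intended object: for odd \<open>N\<close> it
  is a Hopf algebra (\<open>masuoka_hopf\<close>), the defining relations hold, its basis vectors are the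
  \<open>e\<^sub>i\<^sub>j x\<^sup>k\<close>, \<open>\<Delta>\<close> and \<open>\<epsilon>\<close> have the prescribed values on the generators (\<open>masuoka_relations\<close>),
  and it has exactly one normalized integral (\<open>masuoka_integral\<close>).
\<close>

lemma powi_cong:
  fixes z :: complex
  assumes "z ^ N = 1" "N > 0" "[a = b] (mod int N)"
  shows "z powi a = z powi b"
proof -
  have z: "z \<noteq> 0" using assms(1,2) by (auto simp: power_0_left)
  obtain m where m: "a = b + int N * m"
    using assms(3) by (metis cong_iff_lin cong_sym mult.commute)
  have "z powi a = z powi b * (z powi (int N)) powi m"
    using z by (simp add: m power_int_add power_int_mult)
  then show ?thesis using assms(1) by simp
qed

lemma amul_bvec:
  assumes "finite (basis A)" "a \<in> basis A" "b \<in> basis A"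
  shows "amul A (bvec a) (bvec b) = sconst A a b"
proof
  fix c
  have "amul A (bvec a) (bvec b) c
     = (\<Sum>x\<in>basis A. \<Sum>y\<in>basis A. if x = a then if y = b then sconst A x y c else 0 else 0)"
    unfolding amul_def bvec_def by (intro sum.cong) auto
  also have "\<dots> = (\<Sum>x\<in>basis A. if x = a then sconst A x b c else 0)"
    using assms by (intro sum.cong) auto
  finally show "amul A (bvec a) (bvec b) c = sconst A a b c" using assms by simp
qed

lemma amul_scale:
  "amul A (\<lambda>c. s * u c) (\<lambda>c. t * v c) = (\<lambda>c. s * t * amul A u v c)"
  unfolding amul_def by (auto simp: sum_distrib_left mult_ac)

lemma amul_lin:
  "amul A (\<lambda>c. \<Sum>x\<in>X. f x * u x c) (\<lambda>c. \<Sum>y\<in>Y. g y * v y c)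
     = (\<lambda>c. \<Sum>x\<in>X. \<Sum>y\<in>Y. f x * g y * amul A (u x) (v y) c)" (is "?L = ?R")
proof
  fix c
  have "?L c = (\<Sum>a\<in>basis A. \<Sum>b\<in>basis A. \<Sum>x\<in>X. \<Sum>y\<in>Y.
      f x * g y * (u x a * v y b * sconst A a b c))"
    unfolding amul_def
    unfolding sum_product unfolding sum_distrib_right
    by (intro sum.cong refl) (simp add: mult_ac)
  also have "\<dots> = (\<Sum>a\<in>basis A. \<Sum>x\<in>X. \<Sum>b\<in>basis A. \<Sum>y\<in>Y.
      f x * g y * (u x a * v y b * sconst A a b c))"
    by (intro sum.cong refl sum.swap)
  also have "\<dots> = (\<Sum>x\<in>X. \<Sum>a\<in>basis A. \<Sum>b\<in>basis A. \<Sum>y\<in>Y.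
      f x * g y * (u x a * v y b * sconst A a b c))"
    by (rule sum.swap)
  also have "\<dots> = (\<Sum>x\<in>X. \<Sum>a\<in>basis A. \<Sum>y\<in>Y. \<Sum>b\<in>basis A.
      f x * g y * (u x a * v y b * sconst A a b c))"
    by (intro sum.cong refl sum.swap)
  also have "\<dots> = (\<Sum>x\<in>X. \<Sum>y\<in>Y. \<Sum>a\<in>basis A. \<Sum>b\<in>basis A.
      f x * g y * (u x a * v y b * sconst A a b c))"
    by (intro sum.cong refl sum.swap)
  also have "\<dots> = ?R c"
    unfolding amul_def by (simp add: sum_distrib_left)
  finally show "?L c = ?R c" .
qed

lemma elts_expand:
  assumes "finite (basis A)" "u \<in> elts A"
  shows "u = (\<lambda>c. \<Sum>b\<in>basis A. u b * bvec b c)"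
proof
  fix c
  have "(\<Sum>b\<in>basis A. u b * bvec b c) = (\<Sum>b\<in>basis A. if b = c then u b else 0)"
    unfolding bvec_def by (intro sum.cong) auto
  then show "u c = (\<Sum>b\<in>basis A. u b * bvec b c)"
    using assms by (auto simp: elts_def)
qed

lemma amul_tens:
  "amul (tensor_alg A B) (tens u v) (tens u' v') = tens (amul A u u') (amul B v v')"
proof
  fix c :: "'a \<times> 'b"
  obtain c1 c2 where c: "c = (c1, c2)" by force
  have "amul (tensor_alg A B) (tens u v) (tens u' v') c =
    (\<Sum>a\<in>basis A. \<Sum>b\<in>basis B. \<Sum>a'\<in>basis A. \<Sum>b'\<in>basis B.
       (u a * u' a' * sconst A a a' c1) * (v b * v' b' * sconst B b b' c2))"
    unfolding amul_def tensor_alg_def tens_def c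
    by (simp add: sum.cartesian_product' mult_ac)
  also have "\<dots> = (\<Sum>a\<in>basis A. \<Sum>a'\<in>basis A. \<Sum>b\<in>basis B. \<Sum>b'\<in>basis B.
       (u a * u' a' * sconst A a a' c1) * (v b * v' b' * sconst B b b' c2))"
    by (intro sum.cong refl sum.swap)
  also have "\<dots> = tens (amul A u u') (amul B v v') c"
    unfolding amul_def tens_def c
    by (simp add: sum_distrib_left[symmetric] sum_distrib_right[symmetric])
  finally show "amul (tensor_alg A B) (tens u v) (tens u' v') c = tens (amul A u u') (amul B v v') c" .
qed

lemma amul_assocI:
  assumes "finite (basis A)"
    and "\<And>a b. a \<in> basis A \<Longrightarrow> b \<in> basis A \<Longrightarrow> sconst A a b \<in> elts A"
    and as: "\<And>a b c. a \<in> basis A \<Longrightarrow> b \<in> basis A \<Longrightarrow> c \<in> basis A \<Longrightarrow>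
       amul A (sconst A a b) (bvec c) = amul A (bvec a) (sconst A b c)"
    and "u \<in> elts A" "v \<in> elts A" "w \<in> elts A"
  shows "amul A (amul A u v) w = amul A u (amul A v w)"
proof -
  let ?B = "basis A"
  have uv: "amul A u v = (\<lambda>c. \<Sum>p\<in>?B\<times>?B. (u (fst p) * v (snd p)) * sconst A (fst p) (snd p) c)" for u v
    unfolding amul_def by (simp add: sum.cartesian_product case_prod_unfold)
  have "amul A (amul A u v) w = amul A (amul A u v) (\<lambda>c. \<Sum>b\<in>?B. w b * bvec b c)"
    using elts_expand assms by metis
  also have "\<dots> = (\<lambda>d. \<Sum>p\<in>?B\<times>?B. \<Sum>c\<in>?B. u (fst p) * v (snd p) * w c * amul A (sconst A (fst p) (snd p)) (bvec c) d)"
    unfolding uv amul_lin ..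
  also have "\<dots> = (\<lambda>d. \<Sum>p\<in>?B\<times>?B. \<Sum>c\<in>?B. u (fst p) * v (snd p) * w c * amul A (bvec (fst p)) (sconst A (snd p) c) d)"
    by (intro ext sum.cong refl) (auto simp: as)
  also have "\<dots> = (\<lambda>d. \<Sum>a\<in>?B. \<Sum>b\<in>?B. \<Sum>c\<in>?B. u a * v b * w c * amul A (bvec a) (sconst A b c) d)"
    by (simp add: sum.cartesian_product')
  also have "\<dots> = (\<lambda>d. \<Sum>a\<in>?B. \<Sum>p\<in>?B\<times>?B. u a * (v (fst p) * w (snd p)) * amul A (bvec a) (sconst A (fst p) (snd p)) d)"
    by (simp add: sum.cartesian_product' mult_ac)
  also have "\<dots> = amul A (\<lambda>c. \<Sum>b\<in>?B. u b * bvec b c) (amul A v w)"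
    unfolding uv amul_lin ..
  also have "\<dots> = amul A u (amul A v w)"
    using elts_expand assms by metis
  finally show ?thesis .
qed

locale mas =
  fixes N :: nat and \<xi> \<zeta> :: complex
  assumes oddN: "odd N" and xi: "\<xi> ^ N = 1" and ze: "\<zeta> ^ N = 1"
begin

abbreviation "A \<equiv> masuoka_alg N \<xi>"
abbreviation "M \<equiv> monom N \<xi>"
abbreviation "Z \<equiv> {0..<int N}"
abbreviation "T \<equiv> tensor_alg A A"
abbreviation "H \<equiv> masuoka N \<xi> \<zeta>"

lemma N0: "N > 0" using oddN by (rule odd_pos)
lemma xi0: "\<xi> \<noteq> 0" using xi N0 by (auto simp: power_0_left)
lemma ze0: "\<zeta> \<noteq> 0" using ze N0 by (auto simp: power_0_left)

lemma basis_A: "basis A = Z \<times> Z \<times> {..<N}" by (simp add: masuoka_alg_def)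
lemma fin_A: "finite (basis A)" by (simp add: basis_A)

lemma M_bvec: "M i j k = (\<lambda>c. \<xi> powi (j * int (k div N)) * bvec (i mod int N, j mod int N, k mod N) c)"
proof -
  have "\<xi> powi (j mod int N * int (k div N)) = \<xi> powi (j * int (k div N))"
    by (rule powi_cong[OF xi N0]) (simp add: cong_def mod_mult_left_eq)
  then show ?thesis by (auto simp: monom_def bvec_def)
qed

lemma M_cong: "[i = i'] (mod int N) \<Longrightarrow> [j = j'] (mod int N) \<Longrightarrow> M i j k = M i' j' k"
  by (simp only: monom_def cong_def)

lemma M_mod [simp]: "M (i mod int N) j k = M i j k" "M i (j mod int N) k = M i j k"
  by (auto intro!: M_cong)

lemma bas_M: "(i, j, k) \<in> basis A \<Longrightarrow> bvec (i, j, k) = M i j k"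
  by (auto simp: basis_A M_bvec)

lemma in_bas: "(i mod int N, j mod int N, k mod N) \<in> basis A"
  using N0 by (simp add: basis_A)

lemma M_elts: "M i j k \<in> elts A"
  using in_bas by (auto simp: elts_def monom_def)

lemma amul_M: "amul A (M i j k) (M p q l) =
   (if [i = p - int k * q] (mod int N) \<and> [j = q] (mod int N) then M i j (k + l) else (\<lambda>_. 0))"
proof -
  let ?s = "sconst A (i mod int N, j mod int N, k mod N) (p mod int N, q mod int N, l mod N)"
  have c: "i mod int N = (p mod int N - int (k mod N) * (q mod int N)) mod int N \<longleftrightarrow> [i = p - int k * q] (mod int N)"
  proof -
    have "[p mod int N - int (k mod N) * (q mod int N) = p - int k * q] (mod int N)"
      by (intro cong_diff cong_mult) (auto simp: zmod_int)
    then show ?thesis by (simp add: cong_def)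
  qed
  have s: "?s = (if [i = p - int k * q] (mod int N) \<and> [j = q] (mod int N) then M i j (k mod N + l mod N) else (\<lambda>_. 0))"
  proof -
    have "?s = (if i mod int N = (p mod int N - int (k mod N) * (q mod int N)) mod int N \<and> j mod int N = q mod int N
       then M (i mod int N) (j mod int N) (k mod N + l mod N) else (\<lambda>_. 0))"
      by (simp only: masuoka_alg_def alg.simps prod.case)
    then show ?thesis unfolding c M_mod by (simp only: cong_def)
  qed
  have "amul A (M i j k) (M p q l) = (\<lambda>c. \<xi> powi (j * int (k div N)) * \<xi> powi (q * int (l div N)) * ?s c)"
    unfolding M_bvec[of i j k] M_bvec[of p q l] amul_scale
    by (simp add: amul_bvec[OF fin_A in_bas in_bas])
  moreover have "\<xi> powi (j * int (k div N)) * \<xi> powi (q * int (l div N)) * M i j (k mod N + l mod N) c = M i j (k + l) c"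
    if "[j = q] (mod int N)" for c
  proof -
    have 1: "\<xi> powi (q * int (l div N)) = \<xi> powi (j * int (l div N))"
      by (rule powi_cong[OF xi N0 cong_mult[OF cong_sym[OF that] cong_refl]])
    have 2: "(k + l) div N = k div N + l div N + (k mod N + l mod N) div N"
      by (rule div_add1_eq)
    have 3: "(k mod N + l mod N) mod N = (k + l) mod N" by (simp add: mod_simps)
    show ?thesis
      unfolding 1 M_bvec 2 3 using xi0 by (simp add: power_int_add distrib_left)
  qed
  ultimately show ?thesis unfolding s by auto
qed

lemma sc_M: "(i, j, k) \<in> basis A \<Longrightarrow> (p, q, l) \<in> basis A \<Longrightarrow> sconst A (i, j, k) (p, q, l) =
   (if [i = p - int k * q] (mod int N) \<and> [j = q] (mod int N) then M i j (k + l) else (\<lambda>_. 0))"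
  by (metis amul_M amul_bvec bas_M fin_A)

lemma amul_0 [simp]: "amul B (\<lambda>_. 0) v = (\<lambda>_. 0)" "amul B u (\<lambda>_. 0) = (\<lambda>_. 0)"
  by (auto simp: amul_def)

lemma sc_elts: "a \<in> basis A \<Longrightarrow> b \<in> basis A \<Longrightarrow> sconst A a b \<in> elts A"
  by (cases a; cases b) (auto simp: sc_M M_elts, auto simp: elts_def)

lemma A_assoc: "u \<in> elts A \<Longrightarrow> v \<in> elts A \<Longrightarrow> w \<in> elts A \<Longrightarrow> amul A (amul A u v) w = amul A u (amul A v w)"
proof (rule amul_assocI[OF fin_A sc_elts])
  fix a b c assume abc: "a \<in> basis A" "b \<in> basis A" "c \<in> basis A"
  obtain i j k where a: "a = (i, j, k)" by (cases a)
  obtain p q l where b: "b = (p, q, l)" by (cases b)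
  obtain r s m where c: "c = (r, s, m)" by (cases c)
  have *: "[i = r - int (k + l) * s] (mod int N) \<longleftrightarrow> [i = p - int k * q] (mod int N)"
    if "[q = s] (mod int N)" "[p = r - int l * s] (mod int N)"
  proof -
    have "[p - int k * q = (r - int l * s) - int k * s] (mod int N)"
      using that by (intro cong_diff cong_mult) auto
    then have "[p - int k * q = r - int (k + l) * s] (mod int N)"
      by (simp add: algebra_simps)
    then show ?thesis by (metis cong_sym cong_trans)
  qed
  have **: "[p = r - int l * s] (mod int N)"
    if "[q = s] (mod int N)" "[i = p - int k * q] (mod int N)" "[i = r - int (k + l) * s] (mod int N)"
  proof -
    have "[i + int k * q = r - int (k + l) * s + int k * s] (mod int N)"
      using that by (intro cong_add cong_mult) auto
    moreover have "[i + int k * q = p - int k * q + int k * q] (mod int N)"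
      using that by (intro cong_add cong_mult) auto
    ultimately show ?thesis by (simp add: algebra_simps) (metis cong_sym cong_trans)
  qed
  show "amul A (sconst A a b) (bvec c) = amul A (bvec a) (sconst A b c)"
  proof (cases "[j = q] (mod int N) \<and> [q = s] (mod int N)")
    case True
    then have "[j = s] (mod int N)" by (blast intro: cong_trans)
    with True show ?thesis
      using abc * ** unfolding a b c by (auto simp: sc_M bas_M amul_M add.assoc)
  next
    case False
    then have "\<not> ([j = q] (mod int N) \<and> [j = s] (mod int N))" 
      by (meson cong_sym cong_trans)
    with False show ?thesis
      using abc unfolding a b c by (auto simp: sc_M bas_M amul_M)
  qed
qed


abbreviation "ZZ \<equiv> Z \<times> Z"

lemma Zmod [simp]: "a \<in> Z \<Longrightarrow> a mod int N = a" by simp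

lemma Z_iff: "a \<in> Z \<Longrightarrow> [a = b] (mod int N) \<longleftrightarrow> a = b mod int N"
  by (auto simp: cong_def)

lemma modZ: "a mod int N \<in> Z" using N0 by simp

lemma collapse:
  "(\<Sum>p\<in>ZZ. if [fst p = a] (mod int N) \<and> [snd p = b] (mod int N) then f p else 0) =
     (f (a mod int N, b mod int N) :: complex)"
proof -
  have "(\<Sum>p\<in>ZZ. if [fst p = a] (mod int N) \<and> [snd p = b] (mod int N) then f p else 0)
    = (\<Sum>p\<in>ZZ. if p = (a mod int N, b mod int N) then f p else 0)"
    by (intro sum.cong refl if_cong) (auto simp: Z_iff)
  then show ?thesis using modZ by simp
qed

lemma collapse2:
  "(\<Sum>y\<in>ZZ \<times> ZZ. if ([fst (fst y) = a] (mod int N) \<and> [snd (fst y) = b] (mod int N)) \<and>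
        ([fst (snd y) = c] (mod int N) \<and> [snd (snd y) = d] (mod int N)) then f y else 0) =
     (f ((a mod int N, b mod int N), (c mod int N, d mod int N)) :: complex)" (is "?L = _")
proof -
  have "?L = (\<Sum>y\<in>ZZ\<times>ZZ. if y = ((a mod int N, b mod int N), (c mod int N, d mod int N)) then f y else 0)"
    by (intro sum.cong refl if_cong) (auto simp: Z_iff)
  then show ?thesis using modZ by simp
qed

definition X where "X k = (\<lambda>b. \<Sum>p\<in>ZZ. 1 * M (fst p) (snd p) k b)"

lemma unity_A: "unity A = X 0"
  by (simp add: masuoka_alg_def X_def sum.cartesian_product')

lemma gen_x: "gen_x N \<xi> = X 1"
  by (simp add: gen_x_def X_def sum.cartesian_product')

lemma single: "u = (\<lambda>c. \<Sum>x\<in>{()}. 1 * u c)" for u :: "'b \<Rightarrow> complex"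
  by simp

lemma amul_MX: "amul A (M p q l) (X k) = M p q (l + k)"
proof -
  have "amul A (M p q l) (X k) = (\<lambda>c. \<Sum>i\<in>ZZ. 1 * 1 * amul A (M p q l) (M (fst i) (snd i) k) c)"
    by (subst single[of "M p q l"]) (unfold X_def amul_lin, simp)
  also have "\<dots> = (\<lambda>c. \<Sum>i\<in>ZZ. if [fst i = p + int l * q] (mod int N) \<and> [snd i = q] (mod int N) then M p q (l+k) c else 0)"
  proof (intro ext sum.cong refl)
    fix c i
    have "[p = fst i - int l * snd i] (mod int N) \<longleftrightarrow> [fst i = p + int l * q] (mod int N)"
      if "[snd i = q] (mod int N)"
    proof -
      have 1: "[int l * snd i = int l * q] (mod int N)" using that by (intro cong_mult) auto
      show ?thesis
        using cong_add[OF _ 1, of p "fst i - int l * snd i"] cong_diff[OF _ 1, of "fst i" "p + int l * q"]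
          cong_add[OF _ cong_sym[OF 1], of p "fst i - int l * snd i"] 
        by (auto intro: cong_sym)
    qed
    then show "1 * 1 * amul A (M p q l) (M (fst i) (snd i) k) c =
       (if [fst i = p + int l * q] (mod int N) \<and> [snd i = q] (mod int N) then M p q (l+k) c else 0)"
      by (auto simp: amul_M cong_sym_eq)
  qed
  also have "\<dots> = M p q (l + k)" unfolding collapse ..
  finally show ?thesis .
qed

lemma amul_XM: "amul A (X k) (M p q l) = M (p - int k * q) q (k + l)"
proof -
  have "amul A (X k) (M p q l) = (\<lambda>c. \<Sum>i\<in>ZZ. 1 * 1 * amul A (M (fst i) (snd i) k) (M p q l) c)"
    by (subst single[of "M p q l"]) (unfold X_def amul_lin, simp)
  also have "\<dots> = (\<lambda>c. \<Sum>i\<in>ZZ. if [fst i = p - int k * q] (mod int N) \<and> [snd i = q] (mod int N) then M (fst i) (snd i) (k+l) c else 0)"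
    by (intro ext sum.cong refl) (auto simp: amul_M)
  also have "\<dots> = M (p - int k * q) q (k + l)" unfolding collapse by simp
  finally show ?thesis .
qed

lemma A_alg: "assoc_unital A"
proof -
  have u: "unity A \<in> elts A"
    using M_elts by (auto simp: unity_A X_def elts_def)
  have "amul A (X 0) u = u \<and> amul A u (X 0) = u" if u: "u \<in> elts A" for u
  proof -
    have e: "u = (\<lambda>c. \<Sum>b\<in>basis A. u b * bvec b c)" using elts_expand[OF fin_A u] .
    have o: "X 0 = (\<lambda>c. \<Sum>x\<in>{()}. 1 * X 0 c)" by simp
    have b: "amul A (X 0) (bvec b) = bvec b \<and> amul A (bvec b) (X 0) = bvec b" if "b \<in> basis A" for b
      using that by (cases b) (simp add: bas_M amul_XM amul_MX)
    have "amul A (X 0) u = (\<lambda>c. \<Sum>b\<in>basis A. u b * amul A (X 0) (bvec b) c)"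
      by (subst o, subst e, unfold amul_lin, simp)
    moreover have "amul A u (X 0) = (\<lambda>c. \<Sum>b\<in>basis A. u b * amul A (bvec b) (X 0) c)"
      by (subst o, subst e, unfold amul_lin, simp)
    ultimately show ?thesis using b e by (simp cong: sum.cong)
  qed
  then show ?thesis unfolding assoc_unital_def
    using fin_A u sc_elts A_assoc by (auto simp: unity_A)
qed

definition ex where "ex k q r s = int k * q * r + int (k choose 2) * q * s"

lemma choose2_add: "(k + l) choose 2 = (k choose 2) + (l choose 2) + k * l" for k l :: nat
  by (induction l) (auto simp: numeral_2_eq_2)

lemma choose2_mod: "[int ((k mod N) choose 2) = int (k choose 2)] (mod int N)"
proof -
  have "2 * ((N * m) choose 2) = N * m * (N * m - 1)" for m
  proof -
    have "even (x * (x - 1))" for x :: nat by (cases x) auto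
    then show ?thesis by (simp only: choose_two dvd_mult_div_cancel)
  qed
  then have "N dvd 2 * ((N * m) choose 2)" for m by simp
  moreover have "coprime N 2" using oddN by simp
  ultimately have d: "N dvd ((N * m) choose 2)" for m
    by (metis coprime_dvd_mult_right_iff)
  have "k choose 2 = (k mod N + N * (k div N)) choose 2" by simp
  also have "\<dots> = ((k mod N) choose 2) + ((N * (k div N)) choose 2) + (k mod N) * (N * (k div N))"
    by (rule choose2_add)
  finally have "[k choose 2 = ((k mod N) choose 2) + 0 + 0] (mod N)"
    using d[of "k div N"] by (metis cong_0_iff cong_add cong_refl dvd_triv_left dvd_mult)
  then show ?thesis by (simp add: cong_int_iff cong_sym_eq)
qed

lemma ex_cong:
  assumes "[q = q'] (mod int N)" "[r = r'] (mod int N)" "[s = s'] (mod int N)"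
  shows "\<zeta> powi ex k q r s = \<zeta> powi ex k q' r' s'"
  unfolding ex_def by (intro powi_cong[OF ze N0] cong_add cong_mult assms) auto

lemma ex_kmod: "\<zeta> powi ex (k mod N) q r s = \<zeta> powi ex k q r s"
  unfolding ex_def
  by (intro powi_cong[OF ze N0] cong_add cong_mult choose2_mod) (auto simp: zmod_int)

lemma ex_add: "ex (k + l) q r s = ex k q r s + ex l q (r + int k * s) s"
  by (simp add: ex_def choose2_add algebra_simps)

lemma tens_if: "tens (if a then u else (\<lambda>_. 0)) (if b then v else (\<lambda>_. 0)) c = (if a \<and> b then tens u v c else 0)"
  by (auto simp: tens_def)

definition XD where "XD k = (\<lambda>c. \<Sum>x\<in>ZZ\<times>ZZ. \<zeta> powi ex k (snd (fst x)) (fst (snd x)) (snd (snd x)) *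
   tens (M (fst (fst x)) (snd (fst x)) k) (M (fst (snd x)) (snd (snd x)) k) c)"

definition D where "D i j k = (\<lambda>c. \<Sum>x\<in>ZZ. \<zeta> powi ex k (j - snd x) (fst x) (snd x) *
   tens (M (i - fst x) (j - snd x) k) (M (fst x) (snd x) k) c)"

lemma Delta_x: "Delta_x N \<xi> \<zeta> = XD 1"
  unfolding Delta_x_def XD_def gen_e_def gen_x amul_MX
  by (simp add: sum.cartesian_product' ex_def binomial_eq_0)

lemma Delta_e: "Delta_e N \<xi> i j = D i j 0"
  unfolding Delta_e_def D_def gen_e_def
  by (simp add: sum.cartesian_product' ex_def binomial_eq_0)

lemma shift: "[p = p' - int k * q'] (mod int N) \<and> [q = q'] (mod int N) \<longleftrightarrow>
   [p' = p + int k * q] (mod int N) \<and> [q' = q] (mod int N)"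
proof -
  have "[p = p' - int k * q'] (mod int N) \<longleftrightarrow> [p' = p + int k * q] (mod int N)" if "[q = q'] (mod int N)"
  proof -
    have 1: "[int k * q = int k * q'] (mod int N)" using that by (intro cong_mult) auto
    show ?thesis
      using cong_add[OF _ 1, of p "p' - int k * q'"] cong_diff[OF _ 1, of "p'" "p + int k * q"]
        cong_diff[OF _ cong_sym[OF 1], of p' "p + int k * q"]
      by (auto simp: cong_sym_eq) 
  qed
  then show ?thesis by (auto simp: cong_sym_eq)
qed

lemma tens_amul_M:
  "amul T (tens (M p q k) (M r s k)) (tens (M p' q' l) (M r' s' l)) c =
   (if ([p' = p + int k * q] (mod int N) \<and> [q' = q] (mod int N)) \<and>
       ([r' = r + int k * s] (mod int N) \<and> [s' = s] (mod int N))
    then tens (M p q (k + l)) (M r s (k + l)) c else 0)"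
  unfolding amul_tens amul_M tens_if shift ..

lemma XD_mult: "amul T (XD k) (XD l) = XD (k + l)"
proof -
  let ?f = "\<lambda>k x. \<zeta> powi ex k (snd (fst x)) (fst (snd x)) (snd (snd x))"
  have "amul T (XD k) (XD l) = (\<lambda>c. \<Sum>x\<in>ZZ\<times>ZZ. \<Sum>y\<in>ZZ\<times>ZZ.
      if ([fst (fst y) = fst (fst x) + int k * snd (fst x)] (mod int N) \<and> [snd (fst y) = snd (fst x)] (mod int N)) \<and>
         ([fst (snd y) = fst (snd x) + int k * snd (snd x)] (mod int N) \<and> [snd (snd y) = snd (snd x)] (mod int N))
      then ?f k x * ?f l y * tens (M (fst (fst x)) (snd (fst x)) (k+l)) (M (fst (snd x)) (snd (snd x)) (k+l)) c else 0)"
    unfolding XD_def amul_lin tens_amul_M by (intro ext sum.cong refl) auto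
  also have "\<dots> = XD (k + l)"
    unfolding collapse2 XD_def
  proof (intro ext sum.cong refl)
    fix c and x :: "(int \<times> int) \<times> (int \<times> int)"
    have "?f l ((a mod int N, snd (fst x) mod int N), (fst (snd x) + int k * snd (snd x)) mod int N, snd (snd x) mod int N)
      = \<zeta> powi ex l (snd (fst x)) (fst (snd x) + int k * snd (snd x)) (snd (snd x))" for a
      by (auto intro!: ex_cong)
    then show "?f k x * ?f l (((fst (fst x) + int k * snd (fst x)) mod int N, snd (fst x) mod int N), (fst (snd x) + int k * snd (snd x)) mod int N, snd (snd x) mod int N)
       * tens (M (fst (fst x)) (snd (fst x)) (k+l)) (M (fst (snd x)) (snd (snd x)) (k+l)) c
     = ?f (k + l) x * tens (M (fst (fst x)) (snd (fst x)) (k+l)) (M (fst (snd x)) (snd (snd x)) (k+l)) c"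
      using ze0 by (simp add: ex_add power_int_add)
  qed
  finally show ?thesis .
qed

lemma unity_T: "unity T = XD 0"
proof
  fix c :: "midx \<times> midx"
  have "unity T c = (\<Sum>x\<in>ZZ. \<Sum>y\<in>ZZ. tens (M (fst x) (snd x) 0) (M (fst y) (snd y) 0) c)"
    by (cases c) (simp add: tensor_alg_def unity_A X_def tens_def sum_product)
  then show "unity T c = XD 0 c"
    unfolding XD_def sum.cartesian_product'[where A = ZZ and B = ZZ]
    by (simp add: ex_def binomial_eq_0)
qed

lemma apow_Dx: "apow T (Delta_x N \<xi> \<zeta>) k = XD k"
  by (induction k) (auto simp: unity_T Delta_x XD_mult)

lemma D_XD: "amul T (D i j 0) (XD k) = D i j k"
proof -
  have "amul T (D i j 0) (XD k) = (\<lambda>c. \<Sum>x\<in>ZZ. \<Sum>y\<in>ZZ\<times>ZZ.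
      if ([fst (fst y) = i - fst x] (mod int N) \<and> [snd (fst y) = j - snd x] (mod int N)) \<and>
         ([fst (snd y) = fst x] (mod int N) \<and> [snd (snd y) = snd x] (mod int N))
      then \<zeta> powi ex k (snd (fst y)) (fst (snd y)) (snd (snd y)) * tens (M (i - fst x) (j - snd x) k) (M (fst x) (snd x) k) c else 0)"
    unfolding D_def XD_def amul_lin tens_amul_M
    by (intro ext sum.cong refl) (auto simp: ex_def binomial_eq_0)
  also have "\<dots> = D i j k"
    unfolding collapse2 D_def
    by (intro ext sum.cong refl arg_cong2[where f="(*)"]) (auto intro!: ex_cong)
  finally show ?thesis .
qed

lemma D_mult: "amul T (D i j k) (D p q l) = 
   (if [i = p - int k * q] (mod int N) \<and> [j = q] (mod int N) then D i j (k + l) else (\<lambda>_. 0))"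
proof -
  let ?C = "[p = i + int k * j] (mod int N) \<and> [q = j] (mod int N)"
  have c: "([p - fst y = i - fst x + int k * (j - snd x)] (mod int N) \<and> [q - snd y = j - snd x] (mod int N)) \<and>
        ([fst y = fst x + int k * snd x] (mod int N) \<and> [snd y = snd x] (mod int N)) \<longleftrightarrow>
        ?C \<and> [fst y = fst x + int k * snd x] (mod int N) \<and> [snd y = snd x] (mod int N)" (is "?L \<longleftrightarrow> ?R") for x y :: "int \<times> int"
  proof
    assume l: ?L
    then have "[p - fst y + fst y = i - fst x + int k * (j - snd x) + (fst x + int k * snd x)] (mod int N)"
       "[q - snd y + snd y = j - snd x + snd x] (mod int N)" by (blast intro: cong_add)+
    with l show ?R by (simp add: algebra_simps)
  next
    assume r: ?R
    then have "[p - fst y = i + int k * j - (fst x + int k * snd x)] (mod int N)"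
       "[q - snd y = j - snd x] (mod int N)" by (blast intro: cong_diff)+
    with r show ?L by (simp add: algebra_simps)
  qed
  have "amul T (D i j k) (D p q l) = (\<lambda>c. \<Sum>x\<in>ZZ. \<Sum>y\<in>ZZ.
      if [fst y = fst x + int k * snd x] (mod int N) \<and> [snd y = snd x] (mod int N)
      then (if ?C then \<zeta> powi ex k (j - snd x) (fst x) (snd x) * \<zeta> powi ex l (q - snd y) (fst y) (snd y) *
         tens (M (i - fst x) (j - snd x) (k + l)) (M (fst x) (snd x) (k + l)) c else 0) else 0)"
    unfolding D_def amul_lin tens_amul_M c by (intro ext sum.cong refl) auto
  also have "\<dots> = (\<lambda>c. \<Sum>x\<in>ZZ. if ?C then \<zeta> powi ex (k + l) (j - snd x) (fst x) (snd x) *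
         tens (M (i - fst x) (j - snd x) (k + l)) (M (fst x) (snd x) (k + l)) c else 0)"
  proof -
    have "\<zeta> powi ex l (q - snd x mod int N) ((fst x + int k * snd x) mod int N) (snd x mod int N)
      = \<zeta> powi ex l (j - snd x) (fst x + int k * snd x) (snd x)" if ?C for x :: "int \<times> int"
      using that by (intro ex_cong cong_diff) auto
    then show ?thesis unfolding collapse using ze0
      by (intro ext sum.cong refl) (simp add: ex_add power_int_add)
  qed
  also have "\<dots> = (if ?C then D i j (k + l) else (\<lambda>_. 0))"
    unfolding D_def by (cases ?C) (simp_all only: if_True if_False sum.neutral_const simp_thms)
  finally show ?thesis using shift[of i p k q j] by simp
qed

lemma H_simps [simp]: "basis H = basis A" "sconst H = sconst A" "unity H = unity A"
   "comul H (i, j, k) = D i j k" "coun H (i, j, k) = (if i = 0 \<and> j = 0 then 1 else 0)"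
  by (simp_all add: masuoka_def masuoka_alg_def alg.defs Delta_e apow_Dx D_XD Let_def
     flip: masuoka_alg_def)


lemma amul_H [simp]: "amul H = amul A"
  by (intro ext) (simp add: amul_def)

lemma elts_H [simp]: "elts H = elts A" by (simp add: elts_def)

lemma T_H [simp]: "tensor_alg H H = T" by (simp add: tensor_alg_def)

lemma basis_T: "basis T = basis A \<times> basis A" by (simp add: tensor_alg_def)

lemma D_elts: "D i j k \<in> elts T"
proof -
  have "M p q k a = 0" if "a \<notin> basis A" for a p q using M_elts[of p q k] that by (cases a) (simp add: elts_def)
  then show ?thesis by (auto simp: elts_def D_def basis_T tens_def intro!: sum.neutral)
qed

lemma M_at: "k < N \<Longrightarrow> M i j k (p, q, l) =
   (if l = k \<and> p \<in> Z \<and> q \<in> Z \<and> [p = i] (mod int N) \<and> [q = j] (mod int N) then 1 else 0)"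
  using N0 by (auto simp: monom_def cong_def)

lemma D_at: assumes k: "k < N"
  shows "D i j k ((p, q, l), (r, s, m)) =
   (if l = k \<and> m = k \<and> p \<in> Z \<and> q \<in> Z \<and> r \<in> Z \<and> s \<in> Z \<and> [p + r = i] (mod int N) \<and> [q + s = j] (mod int N)
    then \<zeta> powi ex k q r s else 0)"
proof -
  have c: "[p = i - x] (mod int N) \<longleftrightarrow> [p + r = i] (mod int N)" if "[x = r] (mod int N)" for p i x r
  proof -
    show ?thesis using cong_add[OF _ that, of p "i - x"] cong_add[OF _ cong_sym[OF that], of p "i - x"]
        cong_diff[OF _ that, of "p + r" i] cong_diff[OF _ cong_sym[OF that], of "p + r" i]
      by auto
  qed
  have "D i j k ((p, q, l), (r, s, m)) = (\<Sum>x\<in>ZZ. if [fst x = r] (mod int N) \<and> [snd x = s] (mod int N) then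
     (if l = k \<and> m = k \<and> p \<in> Z \<and> q \<in> Z \<and> r \<in> Z \<and> s \<in> Z \<and> [p + r = i] (mod int N) \<and> [q + s = j] (mod int N)
      then \<zeta> powi ex k (j - snd x) (fst x) (snd x) else 0) else 0)"
    unfolding D_def tens_def prod.case M_at[OF k]
    using c by (intro sum.cong refl) (auto simp: cong_sym_eq)
  also have "\<dots> = (if l = k \<and> m = k \<and> p \<in> Z \<and> q \<in> Z \<and> r \<in> Z \<and> s \<in> Z \<and> [p + r = i] (mod int N) \<and> [q + s = j] (mod int N)
      then \<zeta> powi ex k (j - s mod int N) (r mod int N) (s mod int N) else 0)"
    unfolding collapse by simp
  also have "\<zeta> powi ex k (j - s mod int N) (r mod int N) (s mod int N) = \<zeta> powi ex k q r s" if "[q + s = j] (mod int N)"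
  proof -
    have "[j - s mod int N = q + s - s] (mod int N)" using that by (intro cong_diff) (auto simp: cong_sym_eq)
    then show ?thesis by (intro ex_cong) auto
  qed
  then have "(if l = k \<and> m = k \<and> p \<in> Z \<and> q \<in> Z \<and> r \<in> Z \<and> s \<in> Z \<and> [p + r = i] (mod int N) \<and> [q + s = j] (mod int N)
      then \<zeta> powi ex k (j - s mod int N) (r mod int N) (s mod int N) else 0) = 
      (if l = k \<and> m = k \<and> p \<in> Z \<and> q \<in> Z \<and> r \<in> Z \<and> s \<in> Z \<and> [p + r = i] (mod int N) \<and> [q + s = j] (mod int N)
    then \<zeta> powi ex k q r s else 0)" by auto
  finally show ?thesis .
qed

lemma sum_bas: "(\<Sum>b\<in>basis A. f b) = (\<Sum>x\<in>ZZ. \<Sum>k<N. f (fst x, snd x, k) :: complex)"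
  by (simp add: basis_A sum.cartesian_product')

lemma sum_bas_collapse:
  assumes "k < N" "\<And>x m. x \<in> ZZ \<Longrightarrow> m < N \<Longrightarrow> f (fst x, snd x, m) = 
     (if m = k \<and> [fst x = a] (mod int N) \<and> [snd x = b] (mod int N) then g (fst x) (snd x) else 0)"
  shows "(\<Sum>x\<in>basis A. f x) = (g (a mod int N) (b mod int N) :: complex)"
proof -
  have "(\<Sum>x\<in>basis A. f x) = (\<Sum>x\<in>ZZ. \<Sum>m<N. if m = k then 
     if [fst x = a] (mod int N) \<and> [snd x = b] (mod int N) then g (fst x) (snd x) else 0 else 0)"
    unfolding sum_bas using assms(2) by (intro sum.cong refl) auto
  also have "\<dots> = (\<Sum>x\<in>ZZ. if [fst x = a] (mod int N) \<and> [snd x = b] (mod int N) then g (fst x) (snd x) else 0)"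
    using assms(1) by simp
  also have "\<dots> = g (a mod int N) (b mod int N)" unfolding collapse by simp
  finally show ?thesis .
qed

lemma Delta_bvec: "b \<in> basis A \<Longrightarrow> Delta H (bvec b) = comul H b"
proof
  fix p assume "b \<in> basis A"
  have "Delta H (bvec b) p = (\<Sum>x\<in>basis A. if x = b then comul H x p else 0)"
    unfolding Delta_def bvec_def by (intro sum.cong) auto
  then show "Delta H (bvec b) p = comul H b p" using \<open>b \<in> basis A\<close> fin_A by simp
qed

lemma Delta_lin: "Delta H (\<lambda>c. \<Sum>x\<in>S. f x * u x c) = (\<lambda>p. \<Sum>x\<in>S. f x * Delta H (u x) p)"
  unfolding Delta_def sum_distrib_right sum_distrib_left by (subst sum.swap) (simp add: mult_ac)

lemma eps_lin: "eps H (\<lambda>c. \<Sum>x\<in>S. f x * u x c) = (\<Sum>x\<in>S. f x * eps H (u x))"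
  unfolding eps_def sum_distrib_right sum_distrib_left by (subst sum.swap) (simp add: mult_ac)

lemma M_red: "M i j k c = \<xi> powi (j * int (k div N)) * M i j (k mod N) c"
  unfolding M_bvec using N0 by simp

lemma D_red: "D (i mod int N) (j mod int N) (k mod N) p * \<xi> powi (j * int (k div N)) = D i j k p"
proof -
  have t: "tens (M (i - r) (j - s) k) (M r s k) p = 
     \<xi> powi (j * int (k div N)) * tens (M (i mod int N - r) (j mod int N - s) (k mod N)) (M r s (k mod N)) p" for r s
  proof -
    have 1: "M (i - r) (j - s) (k mod N) = M (i mod int N - r) (j mod int N - s) (k mod N)"
      by (intro M_cong cong_diff) auto
    have 2: "\<xi> powi (j * int (k div N)) = \<xi> powi ((j - s) * int (k div N)) * \<xi> powi (s * int (k div N))"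
      using xi0 by (simp add: power_int_add[symmetric] algebra_simps)
    show ?thesis
      unfolding tens_def case_prod_unfold M_red[of "i - r" _ k] M_red[of r s k] 1[symmetric] 2
      by (simp only: mult_ac)
  qed
  have "\<zeta> powi ex (k mod N) (j mod int N - s) r s = \<zeta> powi ex k (j - s) r s" for r s
    unfolding ex_kmod by (intro ex_cong cong_diff) auto
  then show ?thesis unfolding D_def t
    by (simp add: sum_distrib_left sum_distrib_right mult_ac)
qed

lemma Delta_M: "Delta H (M i j k) = D i j k"
proof
  fix p
  have "Delta H (M i j k) p = \<xi> powi (j * int (k div N)) * Delta H (bvec (i mod int N, j mod int N, k mod N)) p"
    using Delta_lin[of "\<lambda>_. \<xi> powi (j * int (k div N))" "\<lambda>_. bvec (i mod int N, j mod int N, k mod N)" "{()}"]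
    by (simp add: M_bvec)
  also have "\<dots> = D i j k p"
    using in_bas D_red by (simp add: Delta_bvec mult.commute)
  finally show "Delta H (M i j k) p = D i j k p" .
qed

lemma eps_M: "eps H (M i j k) = (if [i = 0] (mod int N) \<and> [j = 0] (mod int N) then 1 else 0)"
proof -
  have "eps H (M i j k) = (\<Sum>b\<in>basis A. if b = (i mod int N, j mod int N, k mod N) then
     \<xi> powi (j * int (k div N)) * coun H b else 0)"
    unfolding eps_def M_bvec bvec_def by (intro sum.cong) auto
  also have "\<dots> = \<xi> powi (j * int (k div N)) * (if i mod int N = 0 \<and> j mod int N = 0 then 1 else 0)"
    using in_bas fin_A by simp
  also have "\<dots> = (if [i = 0] (mod int N) \<and> [j = 0] (mod int N) then 1 else 0)"
  proof -
    have "\<xi> powi (j * int (k div N)) = \<xi> powi (0 * int (k div N))" if "[j = 0] (mod int N)"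
      by (intro powi_cong[OF xi N0] cong_mult that) auto
    then show ?thesis by (auto simp: cong_def)
  qed
  finally show ?thesis .
qed

lemma hom_basis:
  assumes "a \<in> basis A" "b \<in> basis A"
  shows "Delta H (sconst A a b) = amul T (comul H a) (comul H b)"
    and "eps H (sconst A a b) = coun H a * coun H b"
proof -
  obtain i j k where a: "a = (i, j, k)" by (cases a)
  obtain p q l where b: "b = (p, q, l)" by (cases b)
  have 0: "Delta H (\<lambda>_. 0) = (\<lambda>_. 0)" "eps H (\<lambda>_. 0) = 0" by (auto simp: Delta_def eps_def)
  show "Delta H (sconst A a b) = amul T (comul H a) (comul H b)"
    using assms by (simp add: a b sc_M D_mult Delta_M 0)
  have z: "[i = 0] (mod int N) \<longleftrightarrow> i = 0" "[j = 0] (mod int N) \<longleftrightarrow> j = 0" "[i = p] (mod int N) \<longleftrightarrow> i = p" "[j = q] (mod int N) \<longleftrightarrow> j = q"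
    using assms by (auto simp: a b basis_A cong_def)
  show "eps H (sconst A a b) = coun H a * coun H b"
    using assms z by (auto simp: a b sc_M eps_M 0)
qed

lemma Delta_mult: "Delta H (amul A u v) = amul T (Delta H u) (Delta H v)"
proof -
  let ?B = "basis A"
  have uv: "amul A u v = (\<lambda>c. \<Sum>p\<in>?B\<times>?B. (u (fst p) * v (snd p)) * sconst A (fst p) (snd p) c)"
    unfolding amul_def by (simp add: sum.cartesian_product')
  have "Delta H (amul A u v) = (\<lambda>c. \<Sum>p\<in>?B\<times>?B. (u (fst p) * v (snd p)) * amul T (comul H (fst p)) (comul H (snd p)) c)"
    unfolding uv Delta_lin by (intro ext sum.cong refl) (auto simp: hom_basis)
  also have "\<dots> = amul T (Delta H u) (Delta H v)"
    unfolding Delta_def amul_lin by (simp add: sum.cartesian_product')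
  finally show ?thesis .
qed

lemma eps_mult: "eps H (amul A u v) = eps H u * eps H v"
proof -
  let ?B = "basis A"
  have uv: "amul A u v = (\<lambda>c. \<Sum>p\<in>?B\<times>?B. (u (fst p) * v (snd p)) * sconst A (fst p) (snd p) c)"
    unfolding amul_def by (simp add: sum.cartesian_product')
  have "eps H (amul A u v) = (\<Sum>p\<in>?B\<times>?B. (u (fst p) * v (snd p)) * (coun H (fst p) * coun H (snd p)))"
    unfolding uv eps_lin by (intro ext sum.cong refl) (auto simp: hom_basis)
  also have "\<dots> = eps H u * eps H v"
    unfolding eps_def sum_product by (simp add: sum.cartesian_product' mult_ac)
  finally show ?thesis .
qed

lemma X_at: "k < N \<Longrightarrow> X k (a, b, l) = (if a \<in> Z \<and> b \<in> Z \<and> l = k then 1 else 0)"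
proof -
  assume k: "k < N"
  have "X k (a, b, l) = (\<Sum>x\<in>ZZ. if [fst x = a] (mod int N) \<and> [snd x = b] (mod int N) then (if a \<in> Z \<and> b \<in> Z \<and> l = k then 1 else 0) else 0)"
    unfolding X_def M_at[OF k] by (intro sum.cong refl) (auto simp: cong_sym_eq)
  then show ?thesis unfolding collapse .
qed

lemma Delta_one: "Delta H (unity A) = unity T"
proof
  fix z :: "midx \<times> midx"
  obtain p q l r s m where z: "z = ((p, q, l), (r, s, m))" by (metis prod_cases3 surj_pair)
  have "Delta H (unity A) z = (\<Sum>x\<in>ZZ. D (fst x) (snd x) 0 z)"
    unfolding unity_A X_def Delta_lin Delta_M by simp
  also have "\<dots> = (\<Sum>x\<in>ZZ. if [fst x = p + r] (mod int N) \<and> [snd x = q + s] (mod int N) then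
      if l = 0 \<and> m = 0 \<and> p \<in> Z \<and> q \<in> Z \<and> r \<in> Z \<and> s \<in> Z then 1 else 0 else 0)"
    unfolding z D_at[OF N0] by (intro sum.cong refl) (auto simp: cong_sym_eq ex_def binomial_eq_0)
  also have "\<dots> = unity T z"
    unfolding collapse by (auto simp: z tensor_alg_def tens_def unity_A X_at[OF N0])
  finally show "Delta H (unity A) z = unity T z" .
qed

lemma eps_one: "eps H (unity A) = 1"
proof -
  have "eps H (unity A) = (\<Sum>x\<in>ZZ. if [fst x = 0] (mod int N) \<and> [snd x = 0] (mod int N) then 1 else 0)"
    unfolding unity_A X_def eps_lin eps_M by simp
  then show ?thesis unfolding collapse .
qed

lemma if_prodI:
  "(P \<and> Q \<longleftrightarrow> C \<and> C') \<Longrightarrow> (C \<Longrightarrow> v * v' = w) \<Longrightarrow>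
   (if P then v else 0) * (if Q then v' else 0) = (if C then if C' then w else 0 else (0::complex))"
  by (cases P; cases Q; cases C; cases C') auto

lemma coassoc:
  assumes "b \<in> basis A"
  shows "(\<Sum>a\<in>basis A. comul H b (a, e) * comul H a (c, d)) =
        (\<Sum>a\<in>basis A. comul H b (c, a) * comul H a (d, e))" (is "?L = ?R")
proof -
  obtain i j k where b: "b = (i, j, k)" by (cases b)
  obtain p q l where c: "c = (p, q, l)" by (cases c)
  obtain p' q' l' where d: "d = (p', q', l')" by (cases d)
  obtain p'' q'' l'' where e: "e = (p'', q'', l'')" by (cases e)
  have k: "k < N" using assms by (simp add: b basis_A)
  let ?C = "l = k \<and> l' = k \<and> l'' = k \<and> p \<in> Z \<and> q \<in> Z \<and> p' \<in> Z \<and> q' \<in> Z \<and> p'' \<in> Z \<and> q'' \<in> Z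
     \<and> [p + p' + p'' = i] (mod int N) \<and> [q + q' + q'' = j] (mod int N)"
  have *: "[x + y'' = z] (mod int N) \<longleftrightarrow> [y + y' + y'' = z] (mod int N)" if "[y + y' = x] (mod int N)" for x y y' y'' z
    using cong_add[OF that cong_refl[of y'']] by (simp only: cong_def)
  have **: "[y + x = z] (mod int N) \<longleftrightarrow> [y + y' + y'' = z] (mod int N)" if "[y' + y'' = x] (mod int N)" for x y y' y'' z
    using cong_add[OF cong_refl[of y] that] by (simp only: cong_def add.assoc)
  have 1: "comul H b ((fst x, snd x, m), e) * comul H (fst x, snd x, m) (c, d) =
      (if m = k \<and> [fst x = p + p'] (mod int N) \<and> [snd x = q + q'] (mod int N) then
        if ?C then \<zeta> powi ex k (snd x) p'' q'' * \<zeta> powi ex k q p' q' else 0 else 0)"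
    if x: "x \<in> ZZ" and m: "m < N" for x m
  proof -
    have z: "fst x \<in> Z" "snd x \<in> Z" using x by (auto simp del: atLeastLessThan_iff)
    have s: "[p + p' = fst x] (mod int N) \<longleftrightarrow> [fst x = p + p'] (mod int N)"
      "[q + q' = snd x] (mod int N) \<longleftrightarrow> [snd x = q + q'] (mod int N)" by (rule cong_sym_eq)+
    have i: "[fst x + p'' = i] (mod int N) \<longleftrightarrow> [p + p' + p'' = i] (mod int N)" if "[fst x = p + p'] (mod int N)"
      using * s that by blast
    have j: "[snd x + q'' = j] (mod int N) \<longleftrightarrow> [q + q' + q'' = j] (mod int N)" if "[snd x = q + q'] (mod int N)"
      using * s that by blast
    show ?thesis
      unfolding b c d e H_simps D_at[OF k] D_at[OF m] s
    proof (rule if_prodI, goal_cases)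
      case 1
      show ?case using z i j k by blast
    next
      case 2
      then show ?case by (simp only:)
    qed
  qed
  have 2: "comul H b (c, (fst x, snd x, m)) * comul H (fst x, snd x, m) (d, e) =
      (if m = k \<and> [fst x = p' + p''] (mod int N) \<and> [snd x = q' + q''] (mod int N) then
        if ?C then \<zeta> powi ex k q (fst x) (snd x) * \<zeta> powi ex k q' p'' q'' else 0 else 0)"
    if x: "x \<in> ZZ" and m: "m < N" for x m
  proof -
    have z: "fst x \<in> Z" "snd x \<in> Z" using x by (auto simp del: atLeastLessThan_iff)
    have s: "[p' + p'' = fst x] (mod int N) \<longleftrightarrow> [fst x = p' + p''] (mod int N)"
      "[q' + q'' = snd x] (mod int N) \<longleftrightarrow> [snd x = q' + q''] (mod int N)" by (rule cong_sym_eq)+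
    have i: "[p + fst x = i] (mod int N) \<longleftrightarrow> [p + p' + p'' = i] (mod int N)" if "[fst x = p' + p''] (mod int N)"
      using ** s that by blast
    have j: "[q + snd x = j] (mod int N) \<longleftrightarrow> [q + q' + q'' = j] (mod int N)" if "[snd x = q' + q''] (mod int N)"
      using ** s that by blast
    show ?thesis
      unfolding b c d e H_simps D_at[OF k] D_at[OF m] s
    proof (rule if_prodI, goal_cases)
      case 1
      show ?case using z i j k by blast
    next
      case 2
      then show ?case by (simp only:)
    qed
  qed
  have "?L = (if ?C then \<zeta> powi ex k ((q + q') mod int N) p'' q'' * \<zeta> powi ex k q p' q' else 0)"
    by (rule sum_bas_collapse[OF k, where a = "p + p'" and b = "q + q'" and
        g = "\<lambda>x y. if ?C then \<zeta> powi ex k y p'' q'' * \<zeta> powi ex k q p' q' else 0"])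
      (rule 1)
  moreover have "?R = (if ?C then \<zeta> powi ex k q ((p' + p'') mod int N) ((q' + q'') mod int N) * \<zeta> powi ex k q' p'' q'' else 0)"
    by (rule sum_bas_collapse[OF k, where a = "p' + p''" and b = "q' + q''" and
        g = "\<lambda>x y. if ?C then \<zeta> powi ex k q x y * \<zeta> powi ex k q' p'' q'' else 0"])
      (rule 2)
  moreover have "\<zeta> powi ex k ((q + q') mod int N) p'' q'' * \<zeta> powi ex k q p' q' =
     \<zeta> powi ex k q ((p' + p'') mod int N) ((q' + q'') mod int N) * \<zeta> powi ex k q' p'' q''"
  proof -
    have "\<zeta> powi ex k ((q + q') mod int N) p'' q'' = \<zeta> powi ex k (q + q') p'' q''"
      "\<zeta> powi ex k q ((p' + p'') mod int N) ((q' + q'') mod int N) = \<zeta> powi ex k q (p' + p'') (q' + q'')"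
      by (auto intro!: ex_cong)
    moreover have "ex k (q + q') p'' q'' + ex k q p' q' = ex k q (p' + p'') (q' + q'') + ex k q' p'' q''"
      by (simp add: ex_def algebra_simps)
    ultimately show ?thesis using ze0 by (simp only: power_int_add[OF disjI1, symmetric] simp_thms)
  qed
  ultimately show ?thesis by simp
qed

lemma if_prodI2:
  "(P \<and> Q \<longleftrightarrow> C \<and> C') \<Longrightarrow> (C \<Longrightarrow> C' \<Longrightarrow> v = w) \<Longrightarrow>
   (if P then 1 else 0) * (if Q then v else 0) = (if C then if C' then w else 0 else (0::complex))"
  "(P \<and> Q \<longleftrightarrow> C \<and> C') \<Longrightarrow> (C \<Longrightarrow> C' \<Longrightarrow> v = w) \<Longrightarrow>
   (if Q then v else 0) * (if P then 1 else 0) = (if C then if C' then w else 0 else (0::complex))"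
  by (cases P; cases Q; cases C; cases C'; auto)+

lemma counit:
  assumes "b \<in> basis A"
  shows "(\<Sum>a\<in>basis A. coun H a * comul H b (a, c)) = bvec b c"
    and "(\<Sum>a\<in>basis A. comul H b (c, a) * coun H a) = bvec b c"
proof -
  obtain i j k where b: "b = (i, j, k)" by (cases b)
  obtain p q l where c: "c = (p, q, l)" by (cases c)
  have k: "k < N" and ij: "i \<in> Z" "j \<in> Z" using assms by (auto simp: b basis_A)
  have z: "[x = 0] (mod int N) \<longleftrightarrow> x = 0" if "x \<in> Z" for x using that by (simp add: cong_def)
  have e: "[x = y] (mod int N) \<longleftrightarrow> x = y" if "x \<in> Z" "y \<in> Z" for x y using that by (simp add: cong_def)
  have c0: "c = b \<longleftrightarrow> l = k \<and> p \<in> Z \<and> q \<in> Z \<and> [p = i] (mod int N) \<and> [q = j] (mod int N)"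
    unfolding b c using ij e by blast
  have "(\<Sum>a\<in>basis A. coun H a * comul H b (a, c)) = (if c = b then \<zeta> powi ex k (0 mod int N) p q else 0)"
  proof (rule sum_bas_collapse[OF k, where a = 0 and b = 0 and g = "\<lambda>x y. if c = b then \<zeta> powi ex k y p q else 0"])
    fix x m assume x: "x \<in> ZZ" and m: "m < N"
    then have zx: "fst x \<in> Z" "snd x \<in> Z" by (auto simp del: atLeastLessThan_iff)
    show "coun H (fst x, snd x, m) * comul H b ((fst x, snd x, m), c) =
      (if m = k \<and> [fst x = 0] (mod int N) \<and> [snd x = 0] (mod int N) then if c = b then \<zeta> powi ex k (snd x) p q else 0 else 0)"
      unfolding b c H_simps D_at[OF k] z[OF zx(1)] z[OF zx(2)]
    proof (rule if_prodI2(1), goal_cases)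
      case 1
      show ?case
      proof (cases "fst x = 0 \<and> snd x = 0")
        case True
        then have f: "fst x = 0" "snd x = 0" by auto
        show ?thesis using c0[unfolded b c] zx unfolding f add_0_left by blast
      next
        case False
        then show ?thesis by blast
      qed
    qed (simp only:)
  qed
  then show "(\<Sum>a\<in>basis A. coun H a * comul H b (a, c)) = bvec b c"
    by (simp add: bvec_def ex_def)
  have "(\<Sum>a\<in>basis A. comul H b (c, a) * coun H a) = (if c = b then \<zeta> powi ex k q (0 mod int N) (0 mod int N) else 0)"
  proof (rule sum_bas_collapse[OF k, where a = 0 and b = 0 and g = "\<lambda>x y. if c = b then \<zeta> powi ex k q x y else 0"])
    fix x m assume x: "x \<in> ZZ" and m: "m < N"
    then have zx: "fst x \<in> Z" "snd x \<in> Z" by (auto simp del: atLeastLessThan_iff)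
    show "comul H b (c, (fst x, snd x, m)) * coun H (fst x, snd x, m) =
      (if m = k \<and> [fst x = 0] (mod int N) \<and> [snd x = 0] (mod int N) then if c = b then \<zeta> powi ex k q (fst x) (snd x) else 0 else 0)"
      unfolding b c H_simps D_at[OF k] z[OF zx(1)] z[OF zx(2)]
    proof (rule if_prodI2(2), goal_cases)
      case 1
      show ?case
      proof (cases "fst x = 0 \<and> snd x = 0")
        case True
        then have f: "fst x = 0" "snd x = 0" by auto
        show ?thesis using c0[unfolded b c] zx unfolding f add_0_right by blast
      next
        case False
        then show ?thesis by blast
      qed
    qed (simp only:)
  qed
  then show "(\<Sum>a\<in>basis A. comul H b (c, a) * coun H a) = bvec b c"
    by (simp add: bvec_def ex_def)
qed

definition S :: "midx \<Rightarrow> midx \<Rightarrow> complex" where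
  "S = (\<lambda>(p, q, k) c. \<zeta> powi ex k q p q * \<xi> powi (q * int k) * M (- p - int k * q) (- q) ((N - 1) * k) c)"

lemma S_elts: "S b \<in> elts A"
  using M_elts by (cases b) (auto simp: S_def elts_def)

lemma tens_sum:
  "(\<Sum>(a, a')\<in>basis A \<times> basis A. D i j k (a, a') * F a a')
   = (\<Sum>a\<in>basis A. \<Sum>a'\<in>basis A. D i j k (a, a') * F a a')"
  by (simp add: sum.cartesian_product)

lemma N1: "(N - 1) * k + k = N * k"
  using N0 by (cases N) auto

lemma M_Nk: "M i j (N * k) c = \<xi> powi (j * int k) * M i j 0 c"
  using M_red[of i j "N * k" c] N0 by simp

lemma antipode:
  assumes "b \<in> basis A"
  shows "(\<Sum>(a, a')\<in>basis A \<times> basis A. comul H b (a, a') * amul A (S a) (bvec a') c) = coun H b * unity A c" (is ?L)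
    and "(\<Sum>(a, a')\<in>basis A \<times> basis A. comul H b (a, a') * amul A (bvec a) (S a') c) = coun H b * unity A c" (is ?R)
proof -
  obtain i j k where b: "b = (i, j, k)" by (cases b)
  have k: "k < N" and ij: "i \<in> Z" "j \<in> Z" using assms by (auto simp: b basis_A)
  have z: "coun H b = (if [i = 0] (mod int N) \<and> [j = 0] (mod int N) then 1 else 0)"
    using ij by (simp add: b cong_def)
  have sM: "amul A (\<lambda>c. s * u c) v = (\<lambda>c. s * amul A u v c)" "amul A v (\<lambda>c. s * u c) = (\<lambda>c. s * amul A v u c)" for s u v
    using amul_scale[of A s u 1 v] amul_scale[of A 1 v s u] by simp_all
  have fold: "(\<Sum>a\<in>basis A. \<Sum>a'\<in>basis A. D i j k (a, a') * F a a') =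
     (\<Sum>x\<in>ZZ. \<Sum>y\<in>ZZ. (if [fst x + fst y = i] (mod int N) \<and> [snd x + snd y = j] (mod int N)
        then \<zeta> powi ex k (snd x) (fst y) (snd y) else 0) * F (fst x, snd x, k) (fst y, snd y, k))" for F
  proof -
    have "D i j k ((fst x, snd x, l), (fst y, snd y, m)) = (if l = k \<and> m = k then
        if [fst x + fst y = i] (mod int N) \<and> [snd x + snd y = j] (mod int N)
        then \<zeta> powi ex k (snd x) (fst y) (snd y) else 0 else 0)" if "x \<in> ZZ" "y \<in> ZZ" for x y l m
      unfolding D_at[OF k] using that by (auto simp del: atLeastLessThan_iff)
    then have "(\<Sum>a\<in>basis A. \<Sum>a'\<in>basis A. D i j k (a, a') * F a a') =
      (\<Sum>x\<in>ZZ. \<Sum>l<N. \<Sum>y\<in>ZZ. \<Sum>m<N. if m = k then if l = k then (if [fst x + fst y = i] (mod int N) \<and> [snd x + snd y = j] (mod int N)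
        then \<zeta> powi ex k (snd x) (fst y) (snd y) else 0) * F (fst x, snd x, l) (fst y, snd y, m) else 0 else 0)"
      unfolding sum_bas by (intro sum.cong refl) auto
    also have "\<dots> = (\<Sum>x\<in>ZZ. \<Sum>l<N. \<Sum>y\<in>ZZ. if l = k then (if [fst x + fst y = i] (mod int N) \<and> [snd x + snd y = j] (mod int N)
        then \<zeta> powi ex k (snd x) (fst y) (snd y) else 0) * F (fst x, snd x, l) (fst y, snd y, k) else 0)"
      using k by simp
    also have "\<dots> = (\<Sum>x\<in>ZZ. \<Sum>l<N. if l = k then (\<Sum>y\<in>ZZ. (if [fst x + fst y = i] (mod int N) \<and> [snd x + snd y = j] (mod int N)
        then \<zeta> powi ex k (snd x) (fst y) (snd y) else 0) * F (fst x, snd x, k) (fst y, snd y, k)) else 0)"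
      by (intro sum.cong refl) simp
    finally show ?thesis using k by simp
  qed
  have bM: "bvec (fst x, snd x, k) = M (fst x) (snd x) k" if "x \<in> ZZ" for x
    using that k by (intro bas_M) (auto simp: basis_A)
  have sum0: "[x + y = w] (mod int N) \<longleftrightarrow> [w = 0] (mod int N)" if "[y = - x] (mod int N)" for x y w
    using cong_add[OF cong_refl[of x] that] by (auto simp: cong_def)
  have neg: "[- p - K * q = r - K' * s] (mod int N) \<and> [- q = s] (mod int N) \<longleftrightarrow> [r = - p] (mod int N) \<and> [s = - q] (mod int N)" 
    if "[K' = - K] (mod int N)" for p q r s K K'
  proof -
    have "[- p - K * q = r - K' * s] (mod int N) \<longleftrightarrow> [r = - p] (mod int N)" if s: "[s = - q] (mod int N)"
    proof -
      have "[K' * s = - K * - q] (mod int N)" using \<open>[K' = - K] (mod int N)\<close> s by (rule cong_mult)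
      then have t: "[r - K' * s = r - K * q] (mod int N)" by (intro cong_diff) auto
      have "[- p - K * q = r - K' * s] (mod int N) \<longleftrightarrow> [- p - K * q = r - K * q] (mod int N)"
        using t by (simp only: cong_def)
      also have "\<dots> \<longleftrightarrow> [r = - p] (mod int N)"
        by (simp add: cong_iff_dvd_diff) (metis dvd_minus_iff minus_diff_eq diff_minus_eq_add uminus_add_conv_diff)
      finally show ?thesis .
    qed
    moreover have "[- q = s] (mod int N) \<longleftrightarrow> [s = - q] (mod int N)" by (rule cong_sym_eq)
    ultimately show ?thesis by blast
  qed
  have KN: "[int ((N - 1) * k) = - int k] (mod int N)"
    using N1[of k] by (simp add: cong_iff_dvd_diff) (metis dvd_triv_left of_nat_add of_nat_mult)
  have XX: "unity A c = (\<Sum>x\<in>ZZ. M (fst x) (snd x) 0 c)" for c by (simp add: unity_A X_def)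
  have rw: "(if P \<and> P' then v else 0) * (s * (if Q then u else (\<lambda>_. 0)) c) = (if Q then (if P \<and> P' then v * s * u c else 0) else 0)"
    for P P' Q and v s :: complex and u :: "midx \<Rightarrow> complex" and c by simp
  show ?L
  proof -
    have "(\<Sum>(a, a')\<in>basis A \<times> basis A. comul H b (a, a') * amul A (S a) (bvec a') c) =
      (\<Sum>x\<in>ZZ. \<Sum>y\<in>ZZ. (if [fst x + fst y = i] (mod int N) \<and> [snd x + snd y = j] (mod int N)
        then \<zeta> powi ex k (snd x) (fst y) (snd y) else 0) * amul A (S (fst x, snd x, k)) (M (fst y) (snd y) k) c)"
      unfolding b H_simps tens_sum fold by (intro sum.cong refl) (simp add: bM)
    also have "\<dots> = (\<Sum>x\<in>ZZ. \<Sum>y\<in>ZZ. if [fst y = - fst x] (mod int N) \<and> [snd y = - snd x] (mod int N) then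
       (if [fst x + fst y = i] (mod int N) \<and> [snd x + snd y = j] (mod int N) then
        \<zeta> powi ex k (snd x) (fst y) (snd y) * (\<zeta> powi ex k (snd x) (fst x) (snd x) * \<xi> powi (snd x * int k)) *
         M (- fst x - int k * snd x) (- snd x) (N * k) c else 0) else 0)"
      unfolding S_def prod.case sM amul_M neg[OF KN] rw N1 ..
    also have "\<dots> = (\<Sum>x\<in>ZZ. \<Sum>y\<in>ZZ. if [fst y = - fst x] (mod int N) \<and> [snd y = - snd x] (mod int N) then
       (if [i = 0] (mod int N) \<and> [j = 0] (mod int N) then M (- fst x - int k * snd x) (- snd x) 0 c else 0) else 0)"
    proof (intro sum.cong refl if_cong)
      fix x y :: "int \<times> int" assume *: "[fst y = - fst x] (mod int N) \<and> [snd y = - snd x] (mod int N)"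
      then show "([fst x + fst y = i] (mod int N) \<and> [snd x + snd y = j] (mod int N)) = ([i = 0] (mod int N) \<and> [j = 0] (mod int N))"
        using sum0 by blast
      have "\<zeta> powi ex k (snd x) (fst y) (snd y) = \<zeta> powi ex k (snd x) (- fst x) (- snd x)"
        using * by (intro ex_cong) auto
      also have "ex k (snd x) (- fst x) (- snd x) = - ex k (snd x) (fst x) (snd x)"
        by (simp add: ex_def)
      finally show "\<zeta> powi ex k (snd x) (fst y) (snd y) * (\<zeta> powi ex k (snd x) (fst x) (snd x) * \<xi> powi (snd x * int k)) *
         M (- fst x - int k * snd x) (- snd x) (N * k) c = M (- fst x - int k * snd x) (- snd x) 0 c"
        using ze0 xi0 by (simp add: M_Nk power_int_minus)
    qed
    also have "\<dots> = (\<Sum>x\<in>ZZ. if [i = 0] (mod int N) \<and> [j = 0] (mod int N) then M (- fst x - int k * snd x) (- snd x) 0 c else 0)"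
      unfolding collapse ..
    also have "\<dots> = coun H b * (\<Sum>x\<in>ZZ. M (- fst x - int k * snd x) (- snd x) 0 c)"
      unfolding z by (cases "[i = 0] (mod int N) \<and> [j = 0] (mod int N)")
        (simp_all only: if_True if_False simp_thms mult_1 mult_zero_left sum.neutral_const)
    also have "(\<Sum>x\<in>ZZ. M (- fst x - int k * snd x) (- snd x) 0 c) = unity A c"
    proof -
      obtain p q l where c: "c = (p, q, l)" by (cases c)
      have e: "[p = - x - int k * y] (mod int N) \<and> [q = - y] (mod int N) \<longleftrightarrow> [x = - p + int k * q] (mod int N) \<and> [y = - q] (mod int N)" for x y
      proof -
        have "int N dvd p + x + int k * y \<longleftrightarrow> int N dvd p + x - int k * q" if "int N dvd q + y"
        proof -
          have "p + x + int k * y = (p + x - int k * q) + int k * (q + y)" by (simp add: algebra_simps)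
          then show ?thesis using that by (simp only: dvd_add_left_iff dvd_mult)
        qed
        then show ?thesis by (simp add: cong_iff_dvd_diff algebra_simps) blast
      qed
      have "M (- fst x - int k * snd x) (- snd x) 0 c = (if [fst x = - p + int k * q] (mod int N) \<and> [snd x = - q] (mod int N) then
          if l = 0 \<and> p \<in> Z \<and> q \<in> Z then 1 else 0 else 0)" for x
        unfolding c M_at[OF N0] using e[of "fst x" "snd x"] by auto
      then show ?thesis
        by (simp only: collapse) (auto simp: c unity_A X_at[OF N0])
    qed
    finally show ?thesis .
  qed
  show ?R
  proof -
    have s: "[p = - r - int k * s - int k * - s] (mod int N) \<and> [q = - s] (mod int N) \<longleftrightarrow> [r = - p] (mod int N) \<and> [s = - q] (mod int N)" for p q r s
      by (simp add: cong_iff_dvd_diff) (metis add.commute)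
    have "(\<Sum>(a, a')\<in>basis A \<times> basis A. comul H b (a, a') * amul A (bvec a) (S a') c) =
      (\<Sum>x\<in>ZZ. \<Sum>y\<in>ZZ. (if [fst x + fst y = i] (mod int N) \<and> [snd x + snd y = j] (mod int N)
        then \<zeta> powi ex k (snd x) (fst y) (snd y) else 0) * amul A (M (fst x) (snd x) k) (S (fst y, snd y, k)) c)"
      unfolding b H_simps tens_sum fold by (intro sum.cong refl) (simp add: bM)
    also have "\<dots> = (\<Sum>x\<in>ZZ. \<Sum>y\<in>ZZ. if [fst y = - fst x] (mod int N) \<and> [snd y = - snd x] (mod int N) then
       (if [fst x + fst y = i] (mod int N) \<and> [snd x + snd y = j] (mod int N) then
        \<zeta> powi ex k (snd x) (fst y) (snd y) * (\<zeta> powi ex k (snd y) (fst y) (snd y) * \<xi> powi (snd y * int k)) *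
         M (fst x) (snd x) (k + (N - 1) * k) c else 0) else 0)"
      unfolding S_def prod.case sM amul_M s rw ..
    also have "\<dots> = (\<Sum>x\<in>ZZ. \<Sum>y\<in>ZZ. if [fst y = - fst x] (mod int N) \<and> [snd y = - snd x] (mod int N) then
       (if [i = 0] (mod int N) \<and> [j = 0] (mod int N) then M (fst x) (snd x) 0 c else 0) else 0)"
    proof (intro sum.cong refl if_cong)
      fix x y :: "int \<times> int" assume *: "[fst y = - fst x] (mod int N) \<and> [snd y = - snd x] (mod int N)"
      then show "([fst x + fst y = i] (mod int N) \<and> [snd x + snd y = j] (mod int N)) = ([i = 0] (mod int N) \<and> [j = 0] (mod int N))"
        using sum0 by blast
      have "\<zeta> powi ex k (snd x) (fst y) (snd y) = \<zeta> powi ex k (- snd y) (fst y) (snd y)"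
      proof (intro ex_cong cong_refl)
        show "[snd x = - snd y] (mod int N)" using * by (simp add: cong_iff_dvd_diff add.commute)
      qed
      also have "ex k (- snd y) (fst y) (snd y) = - ex k (snd y) (fst y) (snd y)"
        by (simp add: ex_def)
      finally have 1: "\<zeta> powi ex k (snd x) (fst y) (snd y) * \<zeta> powi ex k (snd y) (fst y) (snd y) = 1"
        using ze0 by (simp add: power_int_minus)
      have "\<xi> powi (snd y * int k) = \<xi> powi (- snd x * int k)"
        using * by (intro powi_cong[OF xi N0] cong_mult) auto
      then have 2: "\<xi> powi (snd y * int k) * \<xi> powi (snd x * int k) = 1"
        using xi0 by (simp add: power_int_minus)
      show "\<zeta> powi ex k (snd x) (fst y) (snd y) * (\<zeta> powi ex k (snd y) (fst y) (snd y) * \<xi> powi (snd y * int k)) *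
         M (fst x) (snd x) (k + (N - 1) * k) c = M (fst x) (snd x) 0 c"
        unfolding add.commute[of k] N1 M_Nk using 1 2
        by (metis (no_types, opaque_lifting) mult.assoc mult_1)
    qed
    also have "\<dots> = coun H b * unity A c"
      unfolding collapse z XX by (cases "[i = 0] (mod int N) \<and> [j = 0] (mod int N)")
        (simp_all only: if_True if_False simp_thms mult_1 mult_zero_left sum.neutral_const)
    finally show ?thesis .
  qed
qed

lemma masuoka_hopf: "hopf_algebra H"
  unfolding hopf_algebra_def
proof (intro conjI ballI allI exI[of _ S])
  show "assoc_unital H" using A_alg by (simp add: assoc_unital_def)
  show "comul H b \<in> elts (tensor_alg H H)" for b using D_elts by (cases b) simp
qed (use coassoc counit Delta_one Delta_mult eps_one eps_mult S_elts antipode in simp_all)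


lemma masuoka_relations:
  "apow H (gen_x N \<xi>) N = (\<lambda>c. \<Sum>i\<in>Z. \<Sum>j\<in>Z. \<xi> powi j * gen_e N \<xi> i j c)"
  "amul H (gen_x N \<xi>) (gen_e N \<xi> i j) = amul H (gen_e N \<xi> (i - j) j) (gen_x N \<xi>)"
  "amul H (gen_e N \<xi> i j) (gen_e N \<xi> p q) =
     (if [i = p] (mod int N) \<and> [j = q] (mod int N) then gen_e N \<xi> i j else (\<lambda>_. 0))"
  "unity H = (\<lambda>c. \<Sum>i\<in>Z. \<Sum>j\<in>Z. gen_e N \<xi> i j c)"
  "(i, j, k) \<in> basis H \<Longrightarrow> bvec (i, j, k) = amul H (gen_e N \<xi> i j) (apow H (gen_x N \<xi>) k)"
  "Delta H (gen_x N \<xi>) = Delta_x N \<xi> \<zeta>"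
  "Delta H (gen_e N \<xi> i j) = Delta_e N \<xi> i j"
  "eps H (gen_x N \<xi>) = 1"
  "eps H (gen_e N \<xi> i j) = (if [i = 0] (mod int N) \<and> [j = 0] (mod int N) then 1 else 0)"
proof -
  have XX: "amul A (X k) (X 1) = X (Suc k)" for k
  proof -
    have "amul A (X k) (X 1) = (\<lambda>c. \<Sum>x\<in>ZZ. \<Sum>y\<in>{()}. 1 * 1 * amul A (M (fst x) (snd x) k) (X 1) c)"
      by (subst single[of "X 1"]) (subst (1) X_def, rule amul_lin)
    also have "\<dots> = X (Suc k)" unfolding amul_MX by (simp add: X_def)
    finally show ?thesis .
  qed
  have ap: "apow H (gen_x N \<xi>) k = X k" for k
    by (induction k) (simp_all add: unity_A gen_x XX del: One_nat_def)
  show "apow H (gen_x N \<xi>) N = (\<lambda>c. \<Sum>i\<in>Z. \<Sum>j\<in>Z. \<xi> powi j * gen_e N \<xi> i j c)"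
    unfolding ap X_def gen_e_def using M_Nk[of _ _ 1] by (simp add: sum.cartesian_product')
  show "amul H (gen_x N \<xi>) (gen_e N \<xi> i j) = amul H (gen_e N \<xi> (i - j) j) (gen_x N \<xi>)"
    by (simp add: gen_x gen_e_def amul_XM amul_MX del: One_nat_def)
  show "amul H (gen_e N \<xi> i j) (gen_e N \<xi> p q) =
     (if [i = p] (mod int N) \<and> [j = q] (mod int N) then gen_e N \<xi> i j else (\<lambda>_. 0))"
    by (simp add: gen_e_def amul_M)
  show "unity H = (\<lambda>c. \<Sum>i\<in>Z. \<Sum>j\<in>Z. gen_e N \<xi> i j c)"
    by (simp add: unity_A X_def gen_e_def sum.cartesian_product')
  show "(i, j, k) \<in> basis H \<Longrightarrow> bvec (i, j, k) = amul H (gen_e N \<xi> i j) (apow H (gen_x N \<xi>) k)"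
    by (simp add: ap gen_e_def amul_MX bas_M)
  show "Delta H (gen_e N \<xi> i j) = Delta_e N \<xi> i j"
    by (simp add: gen_e_def Delta_M Delta_e)
  show "eps H (gen_e N \<xi> i j) = (if [i = 0] (mod int N) \<and> [j = 0] (mod int N) then 1 else 0)"
    by (simp add: gen_e_def eps_M)
  show "eps H (gen_x N \<xi>) = 1"
    unfolding gen_x X_def eps_lin eps_M using collapse[of 0 0 "\<lambda>_. 1"] by simp
  have D1: "amul T (XD 0) (XD 1) = XD 1" by (simp add: XD_mult)
  have "Delta H (X 1) = amul T (Delta H (X 0)) (XD 1)"
  proof -
    have "amul T (Delta H (X 0)) (XD 1) = (\<lambda>c. \<Sum>x\<in>ZZ. \<Sum>y\<in>{()}. 1 * 1 * amul T (D (fst x) (snd x) 0) (XD 1) c)"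
      unfolding X_def Delta_lin Delta_M by (subst single[of "XD 1"], rule amul_lin)
    then show ?thesis unfolding X_def Delta_lin Delta_M D_XD by simp
  qed
  then show "Delta H (gen_x N \<xi>) = Delta_x N \<xi> \<zeta>"
    using Delta_one by (simp add: gen_x Delta_x unity_A[symmetric] unity_T D1 del: One_nat_def)
qed

lemma masuoka_integral: "\<exists>!\<Lambda>. normalized_integral H \<Lambda>"
proof
  let ?L = "\<lambda>c. \<Sum>k<N. (1 / of_nat N) * M 0 0 k c"
  have el: "?L \<in> elts A" using M_elts by (auto simp: elts_def)
  have ep: "eps H ?L = 1" unfolding eps_lin eps_M using N0 by simp
  have per: "M 0 0 (k mod N) = M 0 0 k" for k by (rule ext) (simp add: M_red[of 0 0 k])
  have sh: "(\<Sum>m<N. M 0 0 (k + m) c) = (\<Sum>m<N. M 0 0 m c)" for k c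
  proof (induction k)
    case (Suc k)
    have "(\<Sum>m<N. M 0 0 (Suc k + m) c) + M 0 0 k c = (\<Sum>m<Suc N. M 0 0 (k + m) c)"
      by (simp add: sum.lessThan_Suc_shift del: sum.lessThan_Suc)
    also have "\<dots> = (\<Sum>m<N. M 0 0 (k + m) c) + M 0 0 (k + N) c" by simp
    also have "M 0 0 (k + N) c = M 0 0 k c" using per[of "k + N"] per[of k] by simp
    finally show ?case using Suc by simp
  qed simp
  have b: "amul A (bvec b) ?L = (\<lambda>c. coun H b * ?L c) \<and> amul A ?L (bvec b) = (\<lambda>c. coun H b * ?L c)"
    if b: "b \<in> basis A" for b
  proof -
    obtain i j k where bb: "b = (i, j, k)" by (cases b)
    have z: "[0 = j] (mod int N) \<longleftrightarrow> j = 0" "[j = 0] (mod int N) \<longleftrightarrow> j = 0" "[i = 0] (mod int N) \<longleftrightarrow> i = 0" "[0 = i] (mod int N) \<longleftrightarrow> i = 0"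
      using b by (auto simp: bb basis_A cong_def)
    have 1: "amul A (bvec b) ?L = (\<lambda>c. \<Sum>x\<in>{()}. \<Sum>m<N. 1 * (1 / of_nat N) * amul A (M i j k) (M 0 0 m) c)"
      using b by (subst single[of "bvec b"]) (simp only: amul_lin bb bas_M)
    have 2: "amul A ?L (bvec b) = (\<lambda>c. \<Sum>m<N. \<Sum>x\<in>{()}. (1 / of_nat N) * 1 * amul A (M 0 0 m) (M i j k) c)"
      using b by (subst single[of "bvec b"]) (simp only: amul_lin bb bas_M)
    show ?thesis
    proof (cases "i = 0 \<and> j = 0")
      case True
      then have ij: "i = 0" "j = 0" by auto
      show ?thesis unfolding 1 2 unfolding bb H_simps ij using sh[of k]
        by (simp add: amul_M add.commute sum_divide_distrib[symmetric])
    next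
      case False
      then show ?thesis unfolding 1 2 unfolding bb H_simps
        by (cases "j = 0") (auto simp: amul_M z)
    qed
  qed
  show L: "normalized_integral H ?L"
    unfolding normalized_integral_def
  proof (intro conjI ballI)
    fix h assume h': "h \<in> elts H"
    have u: "(\<Sum>x\<in>{()}. f x) = (f () :: complex)" for f by simp
    from h' have h: "h = (\<lambda>c. \<Sum>b\<in>basis A. h b * bvec b c)" by (intro elts_expand[OF fin_A]) simp
    have "amul A h ?L = (\<lambda>c. \<Sum>b\<in>basis A. \<Sum>x\<in>{()}. h b * 1 * amul A (bvec b) ?L c)"
      by (subst single[of ?L], subst h, rule amul_lin)
    also have "\<dots> = (\<lambda>c. \<Sum>b\<in>basis A. h b * (coun H b * ?L c))"
      unfolding u using b by (intro ext sum.cong refl) (simp only: mult_1_right mult_1)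
    also have "\<dots> = (\<lambda>c. eps H h * ?L c)"
      unfolding eps_def H_simps sum_distrib_right[of _ "basis A"] by (simp only: mult.assoc)
    finally show "amul H h ?L = (\<lambda>c. eps H h * ?L c)" by simp
    have "amul A ?L h = (\<lambda>c. \<Sum>x\<in>{()}. \<Sum>b\<in>basis A. 1 * h b * amul A ?L (bvec b) c)"
      by (subst single[of ?L], subst h, rule amul_lin)
    also have "\<dots> = (\<lambda>c. \<Sum>b\<in>basis A. h b * (coun H b * ?L c))"
      unfolding u using b by (intro ext sum.cong refl) (simp only: mult_1_right mult_1)
    also have "\<dots> = (\<lambda>c. eps H h * ?L c)"
      unfolding eps_def H_simps sum_distrib_right[of _ "basis A"] by (simp only: mult.assoc)
    finally show "amul H ?L h = (\<lambda>c. eps H h * ?L c)" by simp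
  qed (use el ep in simp_all)
  fix L assume "normalized_integral H L"
  with L show "L = ?L" by (auto simp: normalized_integral_def)
qed

end

end

theory Submission
  imports Defs
begin

text \<open>
  The integral is \<open>\<Lambda> = 1/N \<Sum>\<^sub>k e\<^sub>0\<^sub>0 x\<^sup>k\<close>. A term of the iterated comultiplication of \<open>\<Lambda>\<close> contributes to
  \<open>\<nu>\<^sub>n\<close> only if all its tensor factors share the same second index \<open>q\<close> and
  \<open>N\<close> divides \<open>n k\<close>, \<open>n p\<close> and \<open>n q\<close>, where \<open>p\<close> is the first index of the last factor. With
  \<open>d = gcd N n\<close> this leaves
  \<open>\<nu>\<^sub>n = d \<Sum> \<alpha>\<^sup>u\<^sup>v \<beta> ^ (u v)\<^sup>2\<close>, summed over \<open>u, v < d\<close>. Here \<open>\<alpha>\<^sup>d = \<beta>\<^sup>3 = 1\<close>, and \<open>\<beta> = 1\<close> unless the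
  3-adic condition of the theorem holds. For \<open>\<beta> = 1\<close> the sum is \<open>d\<^sup>2 / ord \<alpha>\<close>; otherwise 3 divides
  \<open>d\<close>, and inclusion-exclusion over \<open>3 | u\<close> and \<open>3 | v\<close> reduces it to such sums for \<open>\<alpha>\<close>, \<open>\<alpha>\<^sup>3\<close> and \<open>\<alpha>\<^sup>9\<close>.
\<close>

section \<open>Sweedler powers of the integral\<close>

lemma sum_lists_Suc:
  fixes f :: "'a list \<Rightarrow> 'b::comm_monoid_add"
  shows "(\<Sum>xs | set xs \<subseteq> B \<and> length xs = Suc n. f xs) =
    (\<Sum>b\<in>B. \<Sum>xs | set xs \<subseteq> B \<and> length xs = n. f (b # xs))"
proof -
  let ?L = "{xs. set xs \<subseteq> B \<and> length xs = n}"
  have "(\<Sum>xs | set xs \<subseteq> B \<and> length xs = Suc n. f xs) = (\<Sum>(b, xs)\<in>B \<times> ?L. f (b # xs))"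
    by (rule sum.reindex_bij_witness[where i = "\<lambda>(b, xs). b # xs" and j = "\<lambda>xs. (hd xs, tl xs)"])
      (auto simp: length_Suc_conv)
  then show ?thesis by (simp add: sum.cartesian_product)
qed

lemma sum_list_length_1:
  fixes f :: "'a list \<Rightarrow> 'b::comm_monoid_add"
  shows "(\<Sum>xs | set xs \<subseteq> B \<and> length xs = Suc 0. f xs) = (\<Sum>b\<in>B. f [b])"
proof -
  have "{xs :: 'a list. set xs \<subseteq> B \<and> length xs = 0} = {[]}" by auto
  then show ?thesis by (simp add: sum_lists_Suc del: length_0_conv)
qed

context mas
begin

abbreviation "P \<equiv> sweedler_power H"

lemma sweedler_power_1:
  assumes "h \<in> elts A"
  shows "P 1 h = h"
proof
  fix c
  have "amul A (bvec b) (unity A) = bvec b" if "b \<in> basis A" for b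
    using that by (cases b) (simp add: bas_M unity_A amul_MX)
  then have "P 1 h c = (\<Sum>b\<in>basis A. h b * bvec b c)"
    by (simp add: sweedler_power_def sum_list_length_1)
  then show "P 1 h c = h c" using fun_cong[OF elts_expand[OF fin_A assms], of c] by simp
qed

lemma iter_Delta_lin:
  "iter_Delta H n (\<lambda>c. \<Sum>x\<in>I. f x * u x c) bs = (\<Sum>x\<in>I. f x * iter_Delta H n (u x) bs)"
proof (cases n)
  case (Suc m)
  show ?thesis
    unfolding Suc iter_Delta.simps Delta_lin
    by (cases bs) (simp_all add: sum_distrib_right sum_distrib_left mult.assoc sum.swap[of _ _ I])
qed (auto split: list.split)

lemma sweedler_power_lin:
  "P n (\<lambda>c. \<Sum>x\<in>I. f x * u x c) = (\<lambda>c. \<Sum>x\<in>I. f x * P n (u x) c)"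
  unfolding sweedler_power_def iter_Delta_lin sum_distrib_right sum_distrib_left
  by (subst sum.swap) (simp add: mult.assoc)

text \<open>Peels off the first tensor factor. The recursion starts at exponent 2:
  \<open>P 0\<close> is 0, since the empty list has coefficient 0, and cannot serve as base
  case.\<close>

lemma sweedler_power_Suc_Suc:
  "P (Suc (Suc n)) h =
    (\<lambda>x. \<Sum>b\<in>basis A. \<Sum>c\<in>basis A. Delta H h (b, c) * amul A (bvec b) (P (Suc n) (bvec c)) x)"
proof
  fix x
  let ?L = "{bs. set bs \<subseteq> basis A \<and> length bs = Suc n}"
  let ?f = "\<lambda>bs. foldr (\<lambda>b. amul A (bvec b)) bs (unity A)"
  have *: "(\<Sum>bs\<in>?L. iter_Delta H n (bvec c) bs * amul A (bvec b) (?f bs) x) =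
      amul A (bvec b) (P (Suc n) (bvec c)) x" for b c
    using amul_lin[of A "\<lambda>_. 1" "\<lambda>_. bvec b" "{()}" "iter_Delta H n (bvec c)" ?f ?L]
    by (simp add: sweedler_power_def)
  have "P (Suc (Suc n)) h x = (\<Sum>b\<in>basis A. \<Sum>bs\<in>?L. \<Sum>c\<in>basis A.
      Delta H h (b, c) * (iter_Delta H n (bvec c) bs * amul A (bvec b) (?f bs) x))"
    by (simp add: sweedler_power_def sum_lists_Suc[where n = "Suc n"] sum_distrib_right mult.assoc)
  also have "\<dots> = (\<Sum>b\<in>basis A. \<Sum>c\<in>basis A. Delta H h (b, c) *
      (\<Sum>bs\<in>?L. iter_Delta H n (bvec c) bs * amul A (bvec b) (?f bs) x))"
    unfolding sum_distrib_left by (intro sum.cong refl sum.swap)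
  finally show "P (Suc (Suc n)) h x = (\<Sum>b\<in>basis A. \<Sum>c\<in>basis A.
      Delta H h (b, c) * amul A (bvec b) (P (Suc n) (bvec c)) x)" unfolding * .
qed

text \<open>By linearity, any expression of the coproduct as a sum of elementary tensors can replace
  the expansion in the basis. \<open>D_def\<close> is such an expression for \<open>M i j k\<close>,
  with indices not reduced modulo \<open>N\<close>.\<close>

lemma sweedler_power_Suc_tens:
  assumes "Delta H h = (\<lambda>p. \<Sum>x\<in>I. f x * tens (u x) (v x) p)"
    and "\<And>x. u x \<in> elts A" "\<And>x. v x \<in> elts A"
  shows "P (Suc (Suc n)) h = (\<lambda>c. \<Sum>x\<in>I. f x * amul A (u x) (P (Suc n) (v x)) c)"
proof
  fix c
  have *: "amul A (u x) (P (Suc n) (v x)) c = (\<Sum>a\<in>basis A. \<Sum>b\<in>basis A.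
      u x a * v x b * amul A (bvec a) (P (Suc n) (bvec b)) c)" for x
  proof -
    have "amul A (u x) (P (Suc n) (v x)) = amul A (\<lambda>c. \<Sum>a\<in>basis A. u x a * bvec a c)
        (P (Suc n) (\<lambda>c. \<Sum>b\<in>basis A. v x b * bvec b c))"
      by (simp only: elts_expand[OF fin_A assms(2), symmetric] elts_expand[OF fin_A assms(3), symmetric])
    then show ?thesis by (simp only: sweedler_power_lin amul_lin)
  qed
  let ?w = "\<lambda>a b. amul A (bvec a) (P (Suc n) (bvec b)) c"
  have "P (Suc (Suc n)) h c = (\<Sum>a\<in>basis A. \<Sum>b\<in>basis A. \<Sum>x\<in>I. f x * (u x a * v x b * ?w a b))"
    unfolding sweedler_power_Suc_Suc assms(1) tens_def prod.case sum_distrib_right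
    by (simp only: mult.assoc)
  also have "\<dots> = (\<Sum>a\<in>basis A. \<Sum>x\<in>I. \<Sum>b\<in>basis A. f x * (u x a * v x b * ?w a b))"
    by (intro sum.cong refl sum.swap)
  also have "\<dots> = (\<Sum>x\<in>I. \<Sum>a\<in>basis A. \<Sum>b\<in>basis A. f x * (u x a * v x b * ?w a b))"
    by (rule sum.swap)
  finally show "P (Suc (Suc n)) h c = (\<Sum>x\<in>I. f x * amul A (u x) (P (Suc n) (v x)) c)"
    unfolding * sum_distrib_left .
qed

text \<open>The exponent of \<zeta> collected by \<open>m\<close> tensor factors, in closed form: it
  vanishes for \<open>m = 1\<close>, and passing from \<open>m\<close> to \<open>Suc m\<close> adds
  \<open>ex k q (m * p - (m choose 2) * k * q) (m * q)\<close>, whose last two arguments are the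
  sums of the first and of the second indices of the last \<open>m\<close> factors.\<close>

definition sexp where
  "sexp m k p q = int (m choose 2) * (int k * p * q) - int (m choose 3) * (int k * q)\<^sup>2
     + int (m choose 2) * int (k choose 2) * q\<^sup>2"

text \<open>The summation index \<open>y\<close> belongs to the last of the \<open>Suc m\<close> tensor factors: the product of the
  factors \<open>e\<^sub>p\<^sub>q x\<^sup>k\<close> vanishes unless \<open>q\<close> is constant and \<open>p\<close> drops by \<open>k q\<close> from each factor to
  the previous one.\<close>

lemma sweedler_power_M:
  "P (Suc m) (M i j k) = (\<lambda>c. \<Sum>y\<in>ZZ.
     (if [i = int (Suc m) * fst y - int (Suc m choose 2) * int k * snd y] (mod int N) \<and>
         [j = int (Suc m) * snd y] (mod int N) then \<zeta> powi sexp (Suc m) k (fst y) (snd y) else 0)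
     * M (fst y - int m * int k * snd y) (snd y) (Suc m * k) c)"
proof (induction m arbitrary: i j)
  case 0
  have "(\<lambda>c. \<Sum>y\<in>ZZ.
     (if [i = int (Suc 0) * fst y - int (Suc 0 choose 2) * int k * snd y] (mod int N) \<and>
         [j = int (Suc 0) * snd y] (mod int N) then \<zeta> powi sexp (Suc 0) k (fst y) (snd y) else 0)
     * M (fst y - int 0 * int k * snd y) (snd y) (Suc 0 * k) c) =
     (\<lambda>c. \<Sum>y\<in>ZZ. if [fst y = i] (mod int N) \<and> [snd y = j] (mod int N) then M (fst y) (snd y) k c else 0)"
    by (intro ext sum.cong refl) (auto simp: sexp_def binomial_eq_0 cong_sym_eq)
  also have "\<dots> = M i j k" unfolding collapse by simp
  finally show ?case using sweedler_power_1[OF M_elts] by simp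
next
  case (Suc m)
  let ?m = "Suc m"
  let ?s = "\<lambda>y. int ?m * fst y - int (?m choose 2) * int k * snd y"
  let ?t = "\<lambda>y. int ?m * snd y"
  let ?C = "\<lambda>y. [i = int (Suc ?m) * fst y - int (Suc ?m choose 2) * int k * snd y] (mod int N) \<and>
         [j = int (Suc ?m) * snd y] (mod int N)"
  have "P (Suc ?m) (M i j k) = (\<lambda>c. \<Sum>x\<in>ZZ. \<zeta> powi ex k (j - snd x) (fst x) (snd x) *
      amul A (M (i - fst x) (j - snd x) k) (P ?m (M (fst x) (snd x) k)) c)"
    by (rule sweedler_power_Suc_tens) (simp_all only: Delta_M D_def M_elts)
  \<comment> \<open>By the induction hypothesis \<open>x\<close> is determined by \<open>y\<close>:
    it is the pair of index sums of the last \<open>Suc m\<close> factors. With \<open>y\<close>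
    outermost the inner sum collapses.\<close>
  also have "\<dots> = (\<lambda>c. \<Sum>y\<in>ZZ. \<Sum>x\<in>ZZ. 
      if [fst x = ?s y] (mod int N) \<and> [snd x = ?t y] (mod int N) then
        \<zeta> powi ex k (j - snd x) (fst x) (snd x) * (\<zeta> powi sexp ?m k (fst y) (snd y) *
        amul A (M (i - fst x) (j - snd x) k) (M (fst y - int m * int k * snd y) (snd y) (?m * k)) c) else 0)"
    (is "_ = ?R")
  proof -
    have *: "amul A u (\<lambda>c. \<Sum>y\<in>ZZ. g y * w y c) = (\<lambda>c. \<Sum>y\<in>ZZ. g y * amul A u (w y) c)"
      for u g and w :: "int \<times> int \<Rightarrow> midx \<Rightarrow> complex"
      using amul_lin[of A "\<lambda>_. 1" "\<lambda>_. u" "{()}" g w ZZ] by simp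
    show ?thesis
      unfolding Suc.IH * sum_distrib_left
      by (subst sum.swap) (intro ext sum.cong refl, auto)
  qed
  also have "\<dots> = (\<lambda>c. \<Sum>y\<in>ZZ. (if ?C y then \<zeta> powi sexp (Suc ?m) k (fst y) (snd y) else 0) *
      M (fst y - int ?m * int k * snd y) (snd y) (Suc ?m * k) c)"
    unfolding collapse
  proof (intro ext sum.cong refl)
    fix c and y :: "int \<times> int"
    define p where "p = fst y"
    define q where "q = snd y"
    have M': "M (i - fst (?s y mod int N, ?t y mod int N)) (j - snd (?s y mod int N, ?t y mod int N)) k
       = M (i - ?s y) (j - ?t y) k" by (intro M_cong cong_diff) auto
    have e': "\<zeta> powi ex k (j - snd (?s y mod int N, ?t y mod int N)) (fst (?s y mod int N, ?t y mod int N))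
        (snd (?s y mod int N, ?t y mod int N)) = \<zeta> powi ex k (j - ?t y) (?s y) (?t y)"
      by (intro ex_cong cong_diff) auto
    \<comment> \<open>\<open>1\<close> and \<open>2\<close> restate the nonvanishing condition of
      \<open>amul_M\<close> for the new first factor; in \<open>1\<close>, moving
      \<open>?s y\<close> to the other side is Pascal's rule.\<close>
    have 1: "[i - ?s y = p - int m * int k * q - int k * q] (mod int N) \<longleftrightarrow>
      [i = int (Suc ?m) * p - int (Suc ?m choose 2) * int k * q] (mod int N)"
      unfolding cong_iff_dvd_diff p_def q_def by (simp add: algebra_simps numeral_2_eq_2)
    have 2: "[j - ?t y = q] (mod int N) \<longleftrightarrow> [j = int (Suc ?m) * q] (mod int N)"
      unfolding cong_iff_dvd_diff p_def q_def by (simp add: algebra_simps)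
    have am: "amul A (M (i - ?s y) (j - ?t y) k) (M (p - int m * int k * q) q (?m * k)) =
       (if ?C y then M (i - ?s y) (j - ?t y) (Suc ?m * k) else (\<lambda>_. 0))"
      unfolding amul_M 1 2 by (simp add: p_def q_def)
    show "\<zeta> powi ex k (j - snd (?s y mod int N, ?t y mod int N)) (fst (?s y mod int N, ?t y mod int N))
        (snd (?s y mod int N, ?t y mod int N)) * (\<zeta> powi sexp ?m k (fst y) (snd y) *
        amul A (M (i - fst (?s y mod int N, ?t y mod int N)) (j - snd (?s y mod int N, ?t y mod int N)) k)
          (M (fst y - int m * int k * snd y) (snd y) (?m * k)) c) =
       (if ?C y then \<zeta> powi sexp (Suc ?m) k (fst y) (snd y) else 0) *
      M (fst y - int ?m * int k * snd y) (snd y) (Suc ?m * k) c"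
    proof (cases "?C y")
      case True
      then have t: "[j - ?t y = q] (mod int N)" and s: "[i - ?s y = p - int ?m * int k * q] (mod int N)"
        using 1 2 by (simp_all add: p_def q_def algebra_simps)
      have "\<zeta> powi ex k (j - ?t y) (?s y) (?t y) = \<zeta> powi ex k q (?s y) (?t y)"
        using t by (intro ex_cong) auto
      moreover have "ex k q (?s y) (?t y) + sexp ?m k p q = sexp (Suc ?m) k p q"
        by (simp add: ex_def sexp_def p_def q_def algebra_simps power2_eq_square numeral_2_eq_2 numeral_3_eq_3)
      ultimately have "\<zeta> powi ex k (j - ?t y) (?s y) (?t y) * \<zeta> powi sexp ?m k p q = \<zeta> powi sexp (Suc ?m) k p q"
        using ze0 by (simp only: power_int_add[OF disjI1, symmetric] simp_thms)
      moreover have "M (i - ?s y) (j - ?t y) (Suc ?m * k) = M (p - int ?m * int k * q) q (Suc ?m * k)"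
        by (rule M_cong[OF s t])
      ultimately show ?thesis
        unfolding M' e' using True am unfolding p_def q_def by (simp only: if_True simp_thms mult.assoc[symmetric])
    next
      case False
      then show ?thesis
        unfolding M' e' using am unfolding p_def q_def
        by (simp only: if_False mult_zero_left mult_zero_right)
    qed
  qed
  finally show ?case .
qed

section \<open>The regular character, the integral and the indicator\<close>

lemma reg_char_lin: "reg_char H (\<lambda>c. \<Sum>x\<in>I. f x * u x c) = (\<Sum>x\<in>I. f x * reg_char H (u x))"
proof -
  have "amul A (\<lambda>c. \<Sum>x\<in>I. f x * u x c) v = (\<lambda>c. \<Sum>x\<in>I. f x * amul A (u x) v c)" for v
    using amul_lin[of A f u I "\<lambda>_. 1" "\<lambda>_. v" "{()}"] by simp
  then show ?thesis
    by (simp add: reg_char_def sum_distrib_left sum.swap[of _ _ I])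
qed

text \<open>Left multiplication by \<open>M i j m\<close> sends the basis vector at
  \<open>(p, q, l)\<close> to 0 or to \<open>M i j (m + l)\<close>. A diagonal entry needs
  \<open>N dvd m\<close> and \<open>(p, q)\<close> congruent to \<open>(i, j)\<close>; each of the
  \<open>N\<close> values of \<open>l\<close> then contributes the same power of \<xi>.\<close>

lemma reg_char_M:
  "reg_char H (M i j m) = (if N dvd m then of_nat N * \<xi> powi (j * int (m div N)) else 0)"
proof -
  have *: "amul A (M i j m) (bvec b) b = (if N dvd m \<and> [fst b = i] (mod int N) \<and> [fst (snd b) = j] (mod int N)
     then \<xi> powi (j * int (m div N)) else 0)" if bb: "b \<in> basis A" for b
  proof -
    obtain p q l where b: "b = (p, q, l)" by (cases b)
    have l: "l < N" and p: "p mod int N = p" and q: "q mod int N = q"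
      using bb by (auto simp: b basis_A)
    have "(m + l) mod N = l mod N \<longleftrightarrow> N dvd m" 
      by (metis add.commute mod_eq_dvd_iff_nat add_diff_cancel_left' le_add1)
    then have ml: "(m + l) mod N = l \<longleftrightarrow> N dvd m" using l by simp
    have am: "amul A (M i j m) (bvec b) =
        (if [i = p - int m * q] (mod int N) \<and> [j = q] (mod int N) then M i j (m + l) else (\<lambda>_. 0))"
      unfolding b bas_M[OF bb[unfolded b]] by (rule amul_M)
    show ?thesis
    proof (cases "N dvd m")
      case True
      then obtain m' where m: "m = N * m'" by auto
      have ip: "[i = p - int m * q] (mod int N) \<longleftrightarrow> [p = i] (mod int N)"
      proof -
        have "[p - int m * q = p - 0] (mod int N)" by (intro cong_diff) (auto simp: m cong_0_iff)
        then show ?thesis by (metis cong_sym cong_trans diff_zero)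
      qed
      have "[j mod int N * int m' = j * int m'] (mod int N)" by (intro cong_mult) auto
      then have "\<xi> powi (j mod int N * int m') = \<xi> powi (j * int m')" by (rule powi_cong[OF xi N0])
      then have "M i j (m + l) b = (if [p = i] (mod int N) \<and> [q = j] (mod int N) then \<xi> powi (j * int m') else 0)"
        using l by (auto simp: b monom_def m cong_def p q)
      then show ?thesis
        unfolding am ip using True N0 by (auto simp: b m cong_sym_eq)
    next
      case False
      then have "M i j (m + l) b = 0" using ml by (auto simp: b monom_def)
      then show ?thesis unfolding am using False by simp
    qed
  qed
  have "reg_char H (M i j m) = (\<Sum>b\<in>basis A. if N dvd m \<and> [fst b = i] (mod int N) \<and> [fst (snd b) = j] (mod int N)
     then \<xi> powi (j * int (m div N)) else 0)"
    unfolding reg_char_def H_simps amul_H by (intro sum.cong refl *)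
  also have "\<dots> = (\<Sum>x\<in>ZZ. if [fst x = i] (mod int N) \<and> [snd x = j] (mod int N)
      then (if N dvd m then of_nat N * \<xi> powi (j * int (m div N)) else 0) else 0)"
    unfolding sum_bas by (intro sum.cong refl) auto
  finally show ?thesis unfolding collapse .
qed

text \<open>The product of \<Lambda> with the explicit element \<open>L\<close> is computed in two
  ways: it is \<Lambda>, because \<Lambda> is an integral and \<open>L\<close> has counit 1, and it
  is \<open>L\<close>, because \<open>L\<close> absorbs left factors and \<Lambda> has counit
  1.\<close>

lemma normalized_integral_eq:
  assumes "normalized_integral H \<Lambda>"
  shows "\<Lambda> = (\<lambda>c. \<Sum>k<N. (1 / of_nat N) * M 0 0 k c)"
proof -
  define L where "L = (\<lambda>c. \<Sum>k<N. (1 / of_nat N) * M 0 0 k c)"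
  have \<Lambda>: "\<Lambda> \<in> elts A" "eps H \<Lambda> = 1"
    and h: "\<And>h. h \<in> elts A \<Longrightarrow> amul A \<Lambda> h = (\<lambda>c. eps H h * \<Lambda> c)"
    using assms by (simp_all add: normalized_integral_def)
  have L: "L \<in> elts A"
    using M_elts by (auto simp: L_def elts_def)
  have eps_L: "eps H L = 1"
    unfolding L_def eps_lin eps_M using N0 by simp
  \<comment> \<open>\<open>M 0 0 k\<close> is periodic in \<open>k\<close> with period
    \<open>N\<close>, since \<xi> enters with exponent 0; a shift only permutes the
    summands.\<close>
  have shift_M: "(\<Sum>m<N. M 0 0 (k + m) c) = (\<Sum>m<N. M 0 0 m c)" for k c
  proof (induction k)
    case (Suc k)
    have "M 0 0 (k + N) c = M 0 0 k c" by (simp add: monom_def)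
    then show ?case using Suc sum.lessThan_Suc_shift[of "\<lambda>m. M 0 0 (k + m) c" N] by simp
  qed simp
  have b: "amul A (bvec b) L c = coun H b * L c" if bb: "b \<in> basis A" for b c
  proof -
    obtain i j k where b: "b = (i, j, k)" by (cases b)
    have z: "[i = 0] (mod int N) \<longleftrightarrow> i = 0" "[j = 0] (mod int N) \<longleftrightarrow> j = 0"
      using bb by (auto simp: b basis_A cong_def)
    have "amul A (bvec b) L = (\<lambda>c. \<Sum>m<N. (1 / of_nat N) * amul A (M i j k) (M 0 0 m) c)"
      unfolding b bas_M[OF bb[unfolded b]]
      using amul_lin[of A "\<lambda>_. 1" "\<lambda>_. M i j k" "{()}" "\<lambda>_. 1 / of_nat N" "M 0 0" "{..<N}"]
      by (simp add: L_def)
    then show ?thesis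
      using shift_M[of k] by (auto simp: b amul_M z L_def sum_divide_distrib[symmetric])
  qed
  have "amul A \<Lambda> L = (\<lambda>c. \<Sum>b\<in>basis A. \<Lambda> b * amul A (bvec b) L c)"
    using amul_lin[of A \<Lambda> bvec "basis A" "\<lambda>_. 1" "\<lambda>_. L" "{()}"] elts_expand[OF fin_A \<Lambda>(1)] by simp
  also have "\<dots> = (\<lambda>c. eps H \<Lambda> * L c)"
    unfolding eps_def H_simps sum_distrib_right by (intro ext sum.cong refl) (simp add: b)
  finally show ?thesis using h[OF L] \<Lambda>(2) eps_L by (simp add: L_def)
qed

lemma FS_indicator_sum:
  assumes "n \<ge> 1"
  shows "FS_indicator n H = (\<Sum>k<N. \<Sum>y\<in>ZZ.
     if N dvd n * k \<and> int N dvd int n * fst y - int (n choose 2) * int k * snd y \<and> int N dvd int n * snd y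
     then \<zeta> powi sexp n k (fst y) (snd y) * \<xi> powi (snd y * int (n * k div N)) else 0)"
proof -
  obtain m where n: "n = Suc m" using assms by (cases n) auto
  have \<Lambda>: "(THE \<Lambda>. normalized_integral H \<Lambda>) = (\<lambda>c. \<Sum>k<N. (1 / of_nat N) * M 0 0 k c)"
    by (rule normalized_integral_eq[OF theI'[OF masuoka_integral]])
  \<comment> \<open>\<open>c\<close> is \<open>N\<close>: the weight of the integral cancels the
    factor in \<open>reg_char_M\<close>.\<close>
  have *: "1 / c * ((if P then a else 0) * (if Q then c * b else 0)) = (if Q \<and> P then a * b else 0)"
    if "c \<noteq> 0" for a b c :: complex and P Q
    using that by simp
  show ?thesis
    unfolding FS_indicator_def \<Lambda> sweedler_power_lin n sweedler_power_M reg_char_lin reg_char_M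
    unfolding sum_distrib_left cong_0_iff cong_sym_eq[of 0]
    using N0 by (intro sum.cong refl *) simp
qed

end

section \<open>Sums over roots of unity\<close>

lemma
  assumes "0 < n" "z ^ n = 1"
  shows root_ord_pos: "0 < root_ord z"
    and root_ord_dvd_iff: "z ^ k = 1 \<longleftrightarrow> root_ord z dvd k"
proof -
  have *: "0 < root_ord z \<and> z ^ root_ord z = 1"
    unfolding root_ord_def by (rule LeastI[of _ n]) (use assms in simp)
  then show pos: "0 < root_ord z" by simp
  have mod: "z ^ k = z ^ (k mod root_ord z)"
  proof -
    have "z ^ k = z ^ (root_ord z * (k div root_ord z) + k mod root_ord z)" by simp
    also have "\<dots> = z ^ (k mod root_ord z)" unfolding power_add power_mult using * by simp
    finally show ?thesis .
  qed
  show "z ^ k = 1 \<longleftrightarrow> root_ord z dvd k"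
  proof
    assume "z ^ k = 1"
    then have "\<not> 0 < k mod root_ord z"
      using mod Least_le[of "\<lambda>d. 0 < d \<and> z ^ d = 1" "k mod root_ord z", folded root_ord_def]
        mod_less_divisor[OF pos, of k] by auto
    then show "root_ord z dvd k" by auto
  qed (use mod in auto)
qed

lemma root_ord_power:
  assumes "0 < n" "z ^ n = 1" "0 < k"
  shows "root_ord z = root_ord (z ^ k) * gcd (root_ord z) k"
proof -
  let ?o = "root_ord z" and ?g = "gcd (root_ord z) k"
  have pos: "0 < ?o" by (rule root_ord_pos[OF assms(1,2)])
  have z: "(z ^ k) ^ n = 1" by (metis assms(2) mult.commute power_mult power_one)
  obtain a b where o: "?o = ?g * a" and k: "k = ?g * b" and ab: "coprime a b"
    using gcd_coprime_exists[of ?o k] assms(3) by (metis gcd_eq_0_iff less_irrefl mult.commute)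
  have "root_ord (z ^ k) dvd m \<longleftrightarrow> a dvd m" for m
  proof -
    have "root_ord (z ^ k) dvd m \<longleftrightarrow> z ^ (k * m) = 1"
      unfolding root_ord_dvd_iff[OF assms(1) z, symmetric] power_mult ..
    also have "\<dots> \<longleftrightarrow> ?g * a dvd ?g * (b * m)"
      unfolding root_ord_dvd_iff[OF assms(1,2)] using o k by (metis mult.assoc)
    also have "\<dots> \<longleftrightarrow> a dvd b * m" using pos by (simp only: dvd_mult_cancel1 nat_mult_dvd_cancel_disj) simp
    also have "\<dots> \<longleftrightarrow> a dvd m" using ab by (rule coprime_dvd_mult_right_iff)
    finally show ?thesis .
  qed
  then have "root_ord (z ^ k) = a" by (meson dvd_antisym dvd_refl)
  then show ?thesis using o by (metis mult.commute)
qed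

lemma sum_lessThan_mult_dvd:
  fixes f :: "nat \<Rightarrow> 'a::comm_monoid_add"
  assumes "0 < m"
  shows "(\<Sum>k<d * m. if m dvd k then f k else 0) = (\<Sum>u<d. f (m * u))"
proof -
  have "(\<Sum>k<d * m. if m dvd k then f k else 0) = sum f {k. k < d * m \<and> m dvd k}"
    by (simp add: sum.If_cases lessThan_def Collect_conj_eq)
  also have "\<dots> = (\<Sum>u<d. f (m * u))"
    by (rule sum.reindex_bij_witness[where i = "\<lambda>u. m * u" and j = "\<lambda>k. k div m"])
      (use assms in \<open>auto simp: less_mult_imp_div_less mult.commute[of m]\<close>)
  finally show ?thesis .
qed

text \<open>The inner sum is geometric: it is \<open>b\<close> if the order of \<open>z\<close>
  divides \<open>u\<close>, and 0 otherwise. There are \<open>a / root_ord z\<close> such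
  \<open>u\<close>.\<close>

lemma double_root_sum:
  fixes z :: complex
  assumes "0 < a" "0 < b" "z ^ a = 1" "z ^ b = 1"
  shows "(\<Sum>u<a. \<Sum>v<b. z ^ (u * v)) = of_nat (a * b) / of_nat (root_ord z)"
proof -
  let ?o = "root_ord z"
  have o: "0 < ?o" using root_ord_pos assms by blast
  obtain c where c: "a = c * ?o"
    using root_ord_dvd_iff[OF assms(1,3), of a] assms(3) by (auto simp: dvd_def mult.commute)
  have "(\<Sum>v<b. z ^ (u * v)) = (if ?o dvd u then of_nat b else 0)" for u
  proof -
    have *: "(z ^ u) ^ b = 1" by (metis assms(4) mult.commute power_mult power_one)
    show ?thesis
      using geometric_sum[of "z ^ u" b] *
      by (auto simp: power_mult root_ord_dvd_iff[OF assms(1,3), symmetric])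
  qed
  then have "(\<Sum>u<a. \<Sum>v<b. z ^ (u * v)) = of_nat (c * b)"
    using sum_lessThan_mult_dvd[OF o, of "\<lambda>_. of_nat b :: complex" c] by (simp add: c)
  then show ?thesis using o by (simp add: c)
qed

text \<open>Only the pairs with \<open>u v\<close> prime to 3 see \<open>\<beta>\<close>, since then \<open>(u v)\<^sup>2 = 1\<close> modulo 3; they are
  counted by inclusion-exclusion.\<close>

lemma cubic_double_root_sum:
  fixes \<alpha> \<beta> :: complex
  assumes e: "0 < e" and \<alpha>: "\<alpha> ^ (3 * e) = 1" and \<beta>: "\<beta> ^ 3 = 1"
  shows "(\<Sum>u<3 * e. \<Sum>v<3 * e. \<alpha> ^ (u * v) * \<beta> ^ (u * v)\<^sup>2) = of_nat (e\<^sup>2) *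
    (9 * \<beta> / of_nat (root_ord \<alpha>)
      + (1 - \<beta>) * (6 / of_nat (root_ord (\<alpha> ^ 3)) - 1 / of_nat (root_ord (\<alpha> ^ 9))))"
proof -
  have \<beta>_eq: "\<beta> ^ (w\<^sup>2) = (if 3 dvd w then 1 else \<beta>)" for w
  proof -
    have mod: "\<beta> ^ x = \<beta> ^ (x mod 3)" for x
    proof -
      have "\<beta> ^ x = \<beta> ^ (3 * (x div 3) + x mod 3)" by simp
      also have "\<dots> = \<beta> ^ (x mod 3)" unfolding power_add power_mult by (simp add: \<beta>)
      finally show ?thesis .
    qed
    have "w mod 3 = 0 \<or> w mod 3 = 1 \<or> w mod 3 = 2" by linarith
    then have "w\<^sup>2 mod 3 = (if 3 dvd w then 0 else 1)"
      unfolding power_mod[of w 3 2, symmetric] by (auto simp: dvd_eq_mod_eq_0)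
    then show ?thesis using mod[of "w\<^sup>2"] by auto
  qed
  have p3: "prime (3::nat)" by simp
  have split: "\<alpha> ^ (u * v) * \<beta> ^ (u * v)\<^sup>2 = \<beta> * \<alpha> ^ (u * v) + (1 - \<beta>) *
      ((if 3 dvd u then \<alpha> ^ (u * v) else 0) + (if 3 dvd v then \<alpha> ^ (u * v) else 0)
        - (if 3 dvd u then if 3 dvd v then \<alpha> ^ (u * v) else 0 else 0))" for u v
    unfolding \<beta>_eq prime_dvd_mult_iff[OF p3] by (auto simp: algebra_simps)
  have dvd3: "(\<Sum>u<3 * e. if 3 dvd u then f u else 0) = (\<Sum>u<e. f (3 * u))" for f :: "nat \<Rightarrow> complex"
    using sum_lessThan_mult_dvd[of 3 f e] by (simp add: mult.commute)
  have if_sum: "(\<Sum>v<3 * e. if P then f v else 0) = (if P then sum f {..<3 * e} else 0)"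
    for P and f :: "nat \<Rightarrow> complex" by simp
  \<comment> \<open>Replacing \<open>u\<close> by \<open>3 * u\<close> turns \<alpha> into
    \<open>\<alpha> ^ 3\<close> on an \<open>e\<close> by \<open>3 * e\<close> rectangle; replacing
    both variables gives \<open>\<alpha> ^ 9\<close> on an \<open>e\<close> by \<open>e\<close>
    square.\<close>
  have 3: "(\<alpha> ^ 3) ^ e = 1" "(\<alpha> ^ 3) ^ (3 * e) = 1" and 9: "(\<alpha> ^ 9) ^ e = 1"
    using \<alpha> power_mult[of \<alpha> "3 * e" 3] by (simp_all flip: power_mult add: mult_ac)
  have S1: "(\<Sum>u<3 * e. \<Sum>v<3 * e. \<alpha> ^ (u * v)) = of_nat (e\<^sup>2) * (9 / of_nat (root_ord \<alpha>))"
    using double_root_sum[OF _ _ \<alpha> \<alpha>] e by (simp add: power2_eq_square)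
  have S2: "(\<Sum>u<3 * e. \<Sum>v<3 * e. if 3 dvd u then \<alpha> ^ (u * v) else 0)
      = of_nat (e\<^sup>2) * (3 / of_nat (root_ord (\<alpha> ^ 3)))"
    using double_root_sum[OF _ _ 3] e
    unfolding if_sum dvd3 by (simp add: power2_eq_square flip: power_mult add: mult_ac)
  have S3: "(\<Sum>u<3 * e. \<Sum>v<3 * e. if 3 dvd v then \<alpha> ^ (u * v) else 0)
      = of_nat (e\<^sup>2) * (3 / of_nat (root_ord (\<alpha> ^ 3)))"
    unfolding S2[symmetric]
    by (subst sum.swap) (intro sum.cong refl if_cong arg_cong[where f = "\<lambda>x. \<alpha> ^ x"] mult.commute)
  have S4: "(\<Sum>u<3 * e. \<Sum>v<3 * e. if 3 dvd u then if 3 dvd v then \<alpha> ^ (u * v) else 0 else 0)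
      = of_nat (e\<^sup>2) * (1 / of_nat (root_ord (\<alpha> ^ 9)))"
    using double_root_sum[OF _ _ 9 9] e
    unfolding if_sum dvd3 by (simp add: power2_eq_square flip: power_mult add: mult_ac)
  have "(\<Sum>u<3 * e. \<Sum>v<3 * e. \<alpha> ^ (u * v) * \<beta> ^ (u * v)\<^sup>2) =
     \<beta> * (of_nat (e\<^sup>2) * (9 / of_nat (root_ord \<alpha>))) +
     (1 - \<beta>) * (of_nat (e\<^sup>2) * (3 / of_nat (root_ord (\<alpha> ^ 3)))
       + of_nat (e\<^sup>2) * (3 / of_nat (root_ord (\<alpha> ^ 3))) - of_nat (e\<^sup>2) * (1 / of_nat (root_ord (\<alpha> ^ 9))))"
    unfolding split sum.distrib sum_subtractf sum_distrib_left[symmetric] S1 S2 S3 S4 ..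
  then show ?thesis by (simp add: algebra_simps)
qed

text \<open>The orders of \<open>\<alpha> ^ 3\<close> and \<open>\<alpha> ^ 9\<close> are the order
  of \<alpha> divided by its gcd with 3 and with 9. Multiplied by the order of \<alpha>, the bracket
  in \<open>cubic_double_root_sum\<close> is therefore 9 \<beta> plus 5, 15 or 9 times
  \<open>1 - \<beta>\<close> for 3-adic valuation 0, 1 or at least 2; in the last case \<beta>
  cancels.\<close>

lemma cubic_double_root_sum_cases:
  fixes \<alpha> \<beta> :: complex
  assumes d: "0 < d" "3 dvd d" and \<alpha>: "\<alpha> ^ d = 1" and \<beta>: "\<beta> ^ 3 = 1"
  shows "(\<Sum>u<d. \<Sum>v<d. \<alpha> ^ (u * v) * \<beta> ^ (u * v)\<^sup>2) = of_nat (d\<^sup>2) / (9 * of_nat (root_ord \<alpha>)) *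
    (case multiplicity 3 (root_ord \<alpha>) of 0 \<Rightarrow> 5 + 4 * \<beta> | Suc 0 \<Rightarrow> 3 * (5 - 2 * \<beta>) | _ \<Rightarrow> 9)"
proof -
  obtain e where e: "d = 3 * e" using d(2) ..
  let ?a = "root_ord \<alpha>"
  have a: "0 < ?a" by (rule root_ord_pos[OF d(1) \<alpha>])
  have 3: "?a = root_ord (\<alpha> ^ 3) * gcd ?a 3" and 9: "?a = root_ord (\<alpha> ^ 9) * gcd ?a 9"
    by (rule root_ord_power[OF d(1) \<alpha>]; simp)+
  have p3: "prime (3::nat)" by simp
  have sum: "(\<Sum>u<d. \<Sum>v<d. \<alpha> ^ (u * v) * \<beta> ^ (u * v)\<^sup>2) = of_nat (e\<^sup>2) *
    (9 * \<beta> / of_nat ?a + (1 - \<beta>) * (6 / of_nat (root_ord (\<alpha> ^ 3)) - 1 / of_nat (root_ord (\<alpha> ^ 9))))"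
    unfolding e using d(1) \<alpha> \<beta> by (intro cubic_double_root_sum) (auto simp: e)
  consider "\<not> 3 dvd ?a" | b where "?a = 3 * b" "\<not> 3 dvd b" | b where "?a = 9 * b"
  proof (cases "3 dvd ?a")
    case True
    then obtain b where b: "?a = 3 * b" ..
    show ?thesis
    proof (cases "3 dvd b")
      case True
      then obtain c where "b = 3 * c" ..
      then show ?thesis using b that(3)[of c] by simp
    qed (use b that(2) in blast)
  qed (use that(1) in blast)
  then show ?thesis
  proof cases
    case 1
    then have "coprime ?a 3" "coprime ?a (3 * 3)"
      using p3 by (simp_all only: coprime_mult_right_iff) (metis prime_imp_coprime coprime_commute)+
    then have "root_ord (\<alpha> ^ 3) = ?a" "root_ord (\<alpha> ^ 9) = ?a"
      using 3 9 by simp_all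
    then show ?thesis unfolding sum using 1 a
      by (simp add: not_dvd_imp_multiplicity_0 e field_simps)
  next
    case (2 b)
    then have "coprime b 3"
      using p3 by (metis prime_imp_coprime coprime_commute)
    then have "gcd (3 * b) (3 * 3) = 3" unfolding gcd_mult_distrib_nat[symmetric] by simp
    then have o: "root_ord (\<alpha> ^ 3) = b" "root_ord (\<alpha> ^ 9) = b"
      using 3 9 2 by simp_all
    have "multiplicity 3 ?a = 1"
      using 2 by (intro multiplicity_eqI) auto
    then show ?thesis unfolding sum o using 2 a
      by (simp add: e field_simps)
  next
    case (3 b)
    then have o: "root_ord (\<alpha> ^ 3) = 3 * b" "root_ord (\<alpha> ^ 9) = b"
      using \<open>?a = root_ord (\<alpha> ^ 3) * gcd ?a 3\<close> 9 a by auto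
    have "2 \<le> multiplicity 3 ?a"
      using a 3 by (intro multiplicity_geI) auto
    then obtain m where "multiplicity 3 ?a = Suc (Suc m)"
      by (metis add_2_eq_Suc le_Suc_ex)
    then show ?thesis unfolding sum o using 3 a
      by (simp add: e field_simps)
  qed
qed

section \<open>3-adic valuations of orders and exponents\<close>

text \<open>Taking the power divides the order by \<open>gcd (root_ord z) k\<close>, which is prime
  to 3. This carries the condition on \<xi> over to \<alpha>.\<close>

lemma multiplicity_3_root_ord_power:
  assumes "0 < n" "z ^ n = 1" "0 < k" "\<not> 3 dvd k"
  shows "multiplicity 3 (root_ord (z ^ k)) = multiplicity 3 (root_ord z)"
proof -
  have o: "root_ord z = root_ord (z ^ k) * gcd (root_ord z) k"
    by (rule root_ord_power[OF assms(1-3)])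
  have "\<not> 3 dvd gcd (root_ord z) k" using assms(4) dvd_trans by blast
  then have g: "multiplicity 3 (gcd (root_ord z) k) = 0" by (rule not_dvd_imp_multiplicity_0)
  have "prime_elem (3::nat)" by (simp add: prime_imp_prime_elem)
  moreover have "root_ord (z ^ k) \<noteq> 0" "gcd (root_ord z) k \<noteq> 0"
    using o root_ord_pos[OF assms(1,2)] by (metis less_irrefl mult_0, metis less_irrefl mult_0_right)
  ultimately show ?thesis
    using prime_elem_multiplicity_mult_distrib[of 3 "root_ord (z ^ k)" "gcd (root_ord z) k"] o g by simp
qed

text \<open>In \<open>3 * (n choose 3) = n * ((n - 1) choose 2)\<close> the last factor is prime to
  3, because 3 divides neither \<open>n - 1\<close> nor \<open>n - 2\<close>.\<close>

lemma multiplicity_3_choose_3: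
  assumes "0 < n" "3 dvd n"
  shows "n choose 3 \<noteq> 0" "multiplicity 3 n = Suc (multiplicity 3 (n choose 3))"
proof -
  obtain m where n: "n = Suc (Suc (Suc m))"
    using assms by (metis dvd_imp_le numeral_3_eq_3 less_eqE add_Suc add.left_neutral)
  show nz: "n choose 3 \<noteq> 0" by (simp add: n)
  have eq: "3 * (n choose 3) = n * ((n - 1) choose 2)"
    using Suc_times_binomial_eq[of "Suc (Suc m)" 2] by (simp add: n numeral_3_eq_3 mult.commute)
  have c2: "2 * ((n - 1) choose 2) = (n - 1) * (n - 2)"
    by (simp add: n choose_two)
  have "\<not> 3 dvd (n - 1) * (n - 2)"
  proof -
    have p3: "prime (3::nat)" by simp
    have "\<not> 3 dvd n - 1" "\<not> 3 dvd n - 2" using assms(2) n by presburger+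
    then show ?thesis unfolding prime_dvd_mult_iff[OF p3] by simp
  qed
  then have "\<not> 3 dvd (n - 1) choose 2" unfolding c2[symmetric] by (metis dvd_mult)
  then have "multiplicity 3 ((n - 1) choose 2) = 0" by (rule not_dvd_imp_multiplicity_0)
  moreover have "prime_elem (3::nat)" by (simp add: prime_imp_prime_elem)
  ultimately have "multiplicity 3 (n * ((n - 1) choose 2)) = multiplicity 3 n"
    using assms(1) by (subst prime_elem_multiplicity_mult_distrib) (auto simp: n)
  moreover have "multiplicity 3 (3 * (n choose 3)) = Suc (multiplicity 3 (n choose 3))"
    using nz by (intro multiplicity_times_same) auto
  ultimately show "multiplicity 3 n = Suc (multiplicity 3 (n choose 3))" using eq by simp
qed

text \<open>\<open>3 * (n choose 3)\<close> is a multiple of \<open>n\<close>, and \<open>N\<close>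
  divides \<open>n * N'\<close>. This yields \<open>\<beta> ^ 3 = 1\<close>.\<close>

lemma three_times_exponent:
  assumes "N = gcd N n * N'"
  shows "N dvd 3 * ((n choose 3) * N' ^ 4)"
proof -
  have "3 * (n choose 3) = n * ((n - 1) choose 2)"
    using Suc_times_binomial_eq[of "n - 1" 2] by (cases n) (simp_all add: numeral_3_eq_3 mult.commute)
  moreover have "N' ^ 4 = N' * N' ^ 3" using power_Suc[of N' 3] by simp
  ultimately have "3 * ((n choose 3) * N' ^ 4) = (n * N') * (((n - 1) choose 2) * N' ^ 3)"
    by (metis mult.assoc mult.commute)
  moreover have "N dvd n * N'" using assms by (metis dvd_refl gcd_dvd2 mult_dvd_mono)
  ultimately show ?thesis by simp
qed

text \<open>With \<open>t\<close> the order of \<zeta> this gives \<beta> = 1. The part of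
  \<open>t\<close> prime to 3 divides three times the exponent, hence the exponent; the power of 3
  is settled by comparing valuations.\<close>

lemma root_ord_dvd_exponent:
  assumes "0 < N" "0 < n" and N: "N = gcd N n * N'" and t: "t dvd N"
    and not: "\<not> (multiplicity 3 n = multiplicity 3 N \<and> multiplicity 3 N = multiplicity 3 t \<and> multiplicity 3 t \<ge> 1)"
  shows "t dvd (n choose 3) * N' ^ 4"
proof -
  let ?E = "(n choose 3) * N' ^ 4" and ?m = "multiplicity (3::nat)"
  have p3: "prime_elem (3::nat)" by (simp add: prime_imp_prime_elem)
  have t0: "t \<noteq> 0" using t assms(1) by auto
  have N0: "N' \<noteq> 0" using N assms(1) by (metis less_irrefl mult_0_right)
  have mN: "?m N = ?m (gcd N n) + ?m N'"
    using prime_elem_multiplicity_mult_distrib[OF p3, of "gcd N n" N'] N N0 assms(1) by simp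
  have mo: "?m t \<le> ?m N" using t assms(1) by (intro dvd_imp_multiplicity_le) auto
  have mg: "?m (gcd N n) = min (?m N) (?m n)" using assms(1,2) by (intro multiplicity_gcd) auto
  have 3: "3 ^ ?m t dvd ?E"
  proof (cases "3 dvd n")
    case False
    then have "?m n = 0" by (rule not_dvd_imp_multiplicity_0)
    then have "?m t \<le> ?m N'" using mo mN mg by linarith
    then have "3 ^ ?m t dvd N'" by (rule multiplicity_dvd')
    moreover have "N' dvd N' ^ 4" by (rule dvd_power) simp
    ultimately have "3 ^ ?m t dvd N' ^ 4" by (rule dvd_trans)
    then show ?thesis by (rule dvd_mult)
  next
    case True
    have "?m ?E = ?m (n choose 3) + 4 * ?m N'"
      using multiplicity_3_choose_3(1)[OF assms(2) True] N0
      by (simp add: prime_elem_multiplicity_mult_distrib[OF p3] prime_elem_multiplicity_power_distrib[OF p3])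
    \<comment> \<open>The right side is \<open>?m n - 1 + 4 * ?m N'\<close>, where
      \<open>?m N'\<close> is the excess of \<open>?m N\<close> over \<open>?m n\<close>, or 0. It
      is below \<open>?m N\<close> only if \<open>?m n = ?m N\<close>, and then only by 1, so it is
      below \<open>?m t\<close> only if also \<open>?m t = ?m N\<close>.\<close>
    then have "?m t \<le> ?m ?E"
      using multiplicity_3_choose_3(2)[OF assms(2) True] mN mg mo not by linarith
    then show ?thesis by (rule multiplicity_dvd')
  qed
  obtain r where r: "t = 3 ^ ?m t * r" "\<not> 3 dvd r"
    using multiplicity_decompose'[of t 3] t0 by auto
  have cop: "coprime 3 r" using r(2) prime_imp_coprime[of "3::nat" r] by simp
  have "r dvd t" by (subst r(1)) simp
  then have "r dvd 3 * ?E" using t three_times_exponent[OF N] by (blast intro: dvd_trans)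
  then have "r dvd ?E"
    using cop by (simp add: coprime_dvd_mult_right_iff coprime_commute)
  then have "3 ^ ?m t * r dvd ?E" using cop by (intro divides_mult 3) simp_all
  then show ?thesis using r(1) by argo
qed

section \<open>The indicator as a double sum\<close>

context mas
begin

text \<open>Twice \<open>n choose 2\<close> is a multiple of \<open>n\<close>, and 2 is invertible
  modulo the odd number \<open>N\<close>. This removes the terms with \<open>n choose 2\<close> from
  the index condition and from \<open>sexp\<close>.\<close>

lemma dvd_choose_2_mult:
  assumes "int N dvd int n * q"
  shows "int N dvd int (n choose 2) * q"
proof -
  have "even (n * (n - 1))" by (cases n) auto
  then have "2 * (n choose 2) = n * (n - 1)" by (simp only: choose_two dvd_mult_div_cancel)
  then have "2 * (int (n choose 2) * q) = int (n - 1) * (int n * q)"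
    by (metis (mono_tags, lifting) mult.assoc mult.commute of_nat_mult of_nat_numeral)
  then have "int N dvd 2 * (int (n choose 2) * q)" using assms by (simp only: dvd_mult)
  moreover have "coprime (int N) 2" using oddN by simp
  ultimately show ?thesis by (simp only: coprime_dvd_mult_right_iff)
qed

text \<open>Since \<open>n'\<close> is prime to \<open>N'\<close>, the indices that survive are the
  multiples \<open>N' * u\<close>, \<open>N' * w\<close>, \<open>N' * v\<close>. Of
  \<open>sexp\<close> only the term with \<open>n choose 3\<close> remains, whose sign makes the
  exponent of \<zeta> negative. The variable \<open>w\<close> drops out and yields the factor
  \<open>d\<close>.\<close>

lemma FS_indicator_gcd_sum:
  assumes n: "n \<ge> 1" and d: "d = gcd N n" and N': "N = d * N'" and n': "n = d * n'"
  shows "FS_indicator n H = of_nat d * (\<Sum>u<d. \<Sum>v<d.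
    (\<xi> ^ (N' * n')) ^ (u * v) * (\<zeta> powi (- int ((n choose 3) * N' ^ 4))) ^ (u * v)\<^sup>2)"
proof -
  have d0: "d > 0" and N'0: "N' > 0" using N0 N' by (auto intro: Nat.gr0I)
  have "coprime N' n'"
  proof -
    have "d * gcd N' n' = d"
      using gcd_mult_distrib_nat[of d N' n'] by (simp only: N'[symmetric] n'[symmetric] d[symmetric])
    then show ?thesis using d0 by (simp add: coprime_iff_gcd_eq_1)
  qed
  then have dvd: "N dvd n * k \<longleftrightarrow> N' dvd k" for k
    unfolding N' n' mult.assoc using d0 by (simp add: coprime_dvd_mult_right_iff)
  have dvd_int: "int N dvd int n * int k \<longleftrightarrow> N' dvd k" for k
    unfolding of_nat_mult[symmetric] of_nat_dvd_iff dvd ..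
  define F where "F k p q = \<zeta> powi sexp n k (int p) (int q) * \<xi> powi (int q * int (n * k div N))" for k p q
  \<comment> \<open>The mixed term is a multiple of \<open>N\<close> as soon as \<open>N'\<close>
    divides \<open>k\<close>, so the conditions on the three indices decouple.\<close>
  have cond: "N dvd n * k \<and> int N dvd int n * int p - int (n choose 2) * int k * int q \<and> int N dvd int n * int q
      \<longleftrightarrow> N' dvd k \<and> N' dvd p \<and> N' dvd q" for k p q
  proof -
    have "int N dvd int (n choose 2) * int k * int q" if "N' dvd k"
      using dvd_choose_2_mult[of n "int k"] that by (simp add: dvd_int)
    then show ?thesis unfolding dvd dvd_int[symmetric]
      by (metis dvd dvd_int diff_0_right dvd_diff_commute dvd_add_left_iff diff_add_cancel)
  qed
  have Z_sum: "(\<Sum>p\<in>Z. f p) = (\<Sum>p<N. f (int p))" for f :: "int \<Rightarrow> complex"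
    by (rule sum.reindex_bij_witness[where i = int and j = nat]) auto
  have F: "F (N' * u) (N' * w) (N' * v) = (\<xi> ^ (N' * n')) ^ (u * v) *
      (\<zeta> powi (- int ((n choose 3) * N' ^ 4))) ^ (u * v)\<^sup>2" for u v w
  proof -
    have "n * (N' * u) div N = n' * u"
      using d0 N'0 by (simp add: n' N' mult_ac)
    then have 1: "\<xi> powi (int (N' * v) * int (n * (N' * u) div N)) = (\<xi> ^ (N' * n')) ^ (u * v)"
      by (simp only: of_nat_mult[symmetric] power_int_of_nat power_mult[symmetric]) (simp add: mult_ac)
    have "int N dvd int (n choose 2) * int (N' * u)" "int N dvd int (n choose 2) * int (N' * v)"
      by (rule dvd_choose_2_mult, simp add: dvd_int del: of_nat_mult)+
    then have "int N dvd int (n choose 2) * int (N' * u) * (int (N' * w) * int (N' * v))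
        + int (n choose 2) * int (N' * v) * (int (N' * u choose 2) * int (N' * v))"
      by - (rule dvd_add; rule dvd_mult2; assumption)
    \<comment> \<open>The two sides differ exactly by the two terms just shown to be divisible by
      \<open>N\<close>.\<close>
    then have "[sexp n (N' * u) (int (N' * w)) (int (N' * v)) = - int ((n choose 3) * N' ^ 4) * int ((u * v)\<^sup>2)] (mod int N)"
      unfolding cong_iff_dvd_diff sexp_def by (simp add: algebra_simps power2_eq_square power4_eq_xxxx)
    then have "\<zeta> powi sexp n (N' * u) (int (N' * w)) (int (N' * v)) = \<zeta> powi (- int ((n choose 3) * N' ^ 4) * int ((u * v)\<^sup>2))"
      by (rule powi_cong[OF ze N0])
    also have "\<dots> = (\<zeta> powi (- int ((n choose 3) * N' ^ 4))) ^ (u * v)\<^sup>2"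
      unfolding power_int_mult power_int_of_nat ..
    finally show ?thesis unfolding F_def 1 by (simp only: mult.commute)
  qed
  have "FS_indicator n H = (\<Sum>k<N. \<Sum>p<N. \<Sum>q<N. if N' dvd k \<and> N' dvd p \<and> N' dvd q then F k p q else 0)"
    unfolding FS_indicator_sum[OF n] sum.cartesian_product[symmetric, of _ Z Z] sum.cartesian_product' Z_sum fst_conv snd_conv cond F_def ..
  also have "\<dots> = (\<Sum>k<d * N'. if N' dvd k then \<Sum>p<d * N'. if N' dvd p then \<Sum>q<d * N'. if N' dvd q then F k p q else 0 else 0 else 0)"
    unfolding N'[symmetric] by (intro sum.cong refl) (auto intro!: sum.cong)
  also have "\<dots> = (\<Sum>u<d. \<Sum>w<d. \<Sum>v<d. F (N' * u) (N' * w) (N' * v))"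
    unfolding sum_lessThan_mult_dvd[OF N'0] ..
  finally show ?thesis
    unfolding F by (simp add: sum_distrib_left)
qed

end

theorem theorem5p4:
  fixes N n E1 E2 :: nat and \<xi> \<zeta> \<alpha> \<beta> :: complex
  assumes "odd N" and "\<xi> ^ N = 1" and "\<zeta> ^ N = 1" and "n \<ge> 1"
    and "E1 = (N * n) div (gcd N n) ^ 2"
    and "E2 = (n choose 3) * (N ^ 4 div (gcd N n) ^ 4)"
    and "\<alpha> = \<xi> ^ E1"
    and "\<beta> = \<zeta> powi (- int E2)"
  shows "FS_indicator n (masuoka N \<xi> \<zeta>) =
    (if multiplicity 3 n = multiplicity 3 N \<and>
        multiplicity 3 N = multiplicity 3 (root_ord \<zeta>) \<and>
        multiplicity 3 (root_ord \<zeta>) \<ge> 1 \<and>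
        multiplicity 3 (root_ord \<xi>) \<le> 1
     then of_nat (gcd N n ^ 3) / (9 * of_nat (root_ord \<alpha>)) *
          (if multiplicity 3 (root_ord \<xi>) = 0 then 5 + 4 * \<beta> else 3 * (5 - 2 * \<beta>))
     else of_nat (gcd N n ^ 3) / of_nat (root_ord \<alpha>))"
proof -
  interpret mas N \<xi> \<zeta> by unfold_locales (use assms in auto)
  define d where "d = gcd N n"
  obtain N' n' where N': "N = d * N'" and n': "n = d * n'"
    unfolding d_def by (meson dvd_def gcd_dvd1 gcd_dvd2)
  have d0: "0 < d" and n0: "0 < n" and N'0: "0 < N'" and n'0: "0 < n'"
    using N0 assms(4) N' n' by (auto intro: Nat.gr0I)
  have E1: "E1 = N' * n'"
    using d0 unfolding assms(5) d_def[symmetric] by (subst (1) N', subst (1) n') (simp add: power2_eq_square)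
  have "N ^ 4 div d ^ 4 = N' ^ 4"
    using d0 by (simp add: N' power_mult_distrib)
  then have E2: "E2 = (n choose 3) * N' ^ 4" unfolding assms(6) d_def by simp
  have "N = gcd N n * N'" using N' unfolding d_def .
  note dvd_E2 = root_ord_dvd_exponent[OF N0 n0 this, folded E2]
    and N_dvd = three_times_exponent[OF this, folded E2]
  have \<alpha>: "\<alpha> ^ d = 1"
  proof -
    have "\<alpha> ^ d = (\<xi> ^ N) ^ n'" unfolding assms(7) E1 power_mult[symmetric] by (simp add: N' mult_ac)
    then show ?thesis using xi by simp
  qed
  have \<beta>: "\<beta> ^ 3 = 1"
  proof -
    obtain m where "3 * E2 = N * m" using N_dvd ..
    then have "(\<zeta> ^ E2) ^ 3 = (\<zeta> ^ N) ^ m" by (simp flip: power_mult add: mult.commute)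
    then show ?thesis using ze by (simp add: assms(8) power_int_minus power_inverse)
  qed
  have FS: "FS_indicator n H = of_nat d * (\<Sum>u<d. \<Sum>v<d. \<alpha> ^ (u * v) * \<beta> ^ (u * v)\<^sup>2)"
    unfolding assms(7,8) E1 E2 using FS_indicator_gcd_sum[OF assms(4) d_def N' n'] .
  show ?thesis
  \<comment> \<open>The condition on \<xi> is left out of this split: it re-enters through the
    valuation of the order of \<alpha>. At valuation 2 or more, the value 9 in
    \<open>cubic_double_root_sum_cases\<close> cancels the denominator and gives the generic
    formula.\<close>
  proof (cases "multiplicity 3 n = multiplicity 3 N \<and> multiplicity 3 N = multiplicity 3 (root_ord \<zeta>) \<and>
      multiplicity 3 (root_ord \<zeta>) \<ge> 1")
    case True
    then have "3 dvd N" "3 dvd n" using not_dvd_imp_multiplicity_0 by fastforce+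
    then have "3 dvd d" unfolding d_def by (rule gcd_greatest)
    note sum = cubic_double_root_sum_cases[OF d0 this \<alpha> \<beta>]
    have p3: "prime_elem (3::nat)" by (simp add: prime_imp_prime_elem)
    have m: "multiplicity 3 N = multiplicity 3 d + multiplicity 3 N'" "multiplicity 3 n = multiplicity 3 d + multiplicity 3 n'"
      using d0 N'0 n'0 by (subst N' n', subst prime_elem_multiplicity_mult_distrib[OF p3]; simp)+
    have "multiplicity 3 d = min (multiplicity 3 N) (multiplicity 3 n)"
      unfolding d_def using N0 n0 by (intro multiplicity_gcd) auto
    \<comment> \<open>\<open>N\<close> and \<open>n\<close> have the same 3-adic valuation, so
      \<open>d\<close> takes all of it and \<open>E1 = N' * n'\<close> is prime to 3.\<close>
    then have "multiplicity 3 (N' * n') = 0"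
      using m True N'0 n'0 by (simp add: prime_elem_multiplicity_mult_distrib[OF p3])
    then have "\<not> 3 dvd E1"
      using N'0 n'0 unfolding E1 by (subst multiplicity_eq_zero_iff[symmetric]) auto
    then have mult: "multiplicity 3 (root_ord \<alpha>) = multiplicity 3 (root_ord \<xi>)"
      unfolding assms(7) using N'0 n'0
      by (intro multiplicity_3_root_ord_power[OF N0 xi]) (simp_all add: E1)
    show ?thesis
      using True unfolding FS sum mult d_def[symmetric]
      by (auto simp: power2_eq_square power3_eq_cube split: nat.split)
  next
    case False
    \<comment> \<open>Here \<beta> = 1, and \<open>double_root_sum\<close> for \<alpha> on a
      \<open>d\<close> by \<open>d\<close> square gives the whole sum.\<close>
    then have "root_ord \<zeta> dvd E2"
      using root_ord_dvd_iff[OF N0 ze, of N] ze by (intro dvd_E2) auto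
    then have "\<beta> = 1"
      unfolding assms(8) power_int_minus by (simp add: root_ord_dvd_iff[OF N0 ze, symmetric])
    then show ?thesis
      using False double_root_sum[OF d0 d0 \<alpha> \<alpha>] unfolding FS d_def[symmetric]
      by (auto simp: power3_eq_cube)
  qed
qed

end
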